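(* (a) $\mathcal{U}_R(\mathbb{D})\cap\mathcal{B}=\emptyset$. (b) There exists a set $E\subset\mathbb{T}$ with $m(E)=0$ such that $\mathcal{U}_R^{\mathbb{T}\setminus E}(\mathbb{D})\cap\mathcal{B}\neq\emptyset$.
   Context: $\mathbb{D}$ is the open unit disc, $\mathbb{T}$ the unit circle, $m$ arclength measure on $\mathbb{T}$. For $f\in H(\mathbb{D})$ and $\zeta\in\mathbb{T}$, the radial cluster set $C_{r_\zeta}(f)$ is the set of $w\in\mathbb{C}\cup\{\infty\}$ such that $w=\lim_n f(s_n\zeta)$ for some sequence $(s_n)$ in $[0,1)$ with $s_n\to1$; it is maximal if it equals $\mathbb{C}\cup\{\infty\}$. $\mathcal{U}_R(\mathbb{D})$ is the set of $f\in H(\mathbb{D})$ with $C_{r_\zeta}(f)$ maximal for all $\zeta\in\mathbb{T}$; for $K\subset\mathbb{T}$, $\mathcal{U}_R^K(\mathbb{D})$ is the set of $f\in H(\mathbb{D})$ with $C_{r_\zeta}(f)$ maximal for all $\zeta\in K$. $\mathcal{B}$ is the Bloch space of $f\in H(\mathbb{D})$ with $\sup_{z\in\mathbb{D}}(1-|z|^2)|f'(z)|<\infty$. *)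

theory Defs
  imports "HOL-Analysis.Analysis"
begin

text \<open>Extended complex plane: None represents infinity, Some w a finite point w.\<close>

definition radial_seq :: "(nat \<Rightarrow> real) \<Rightarrow> bool" where
  "radial_seq s \<longleftrightarrow> (\<forall>n. 0 \<le> s n \<and> s n < 1) \<and> s \<longlonglongrightarrow> 1"

definition radial_cluster_set :: "(complex \<Rightarrow> complex) \<Rightarrow> complex \<Rightarrow> complex option set" where
  "radial_cluster_set f \<zeta> =
     {Some w | w. \<exists>s. radial_seq s \<and> (\<lambda>n. f (complex_of_real (s n) * \<zeta>)) \<longlonglongrightarrow> w}
     \<union> (if \<exists>s. radial_seq s \<and>
           filterlim (\<lambda>n. f (complex_of_real (s n) * \<zeta>)) at_infinity sequentially
        then {None} else {})"

definition maximal_cluster :: "complex option set \<Rightarrow> bool" where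
  "maximal_cluster C \<longleftrightarrow> C = UNIV"

definition U_R_on :: "complex set \<Rightarrow> (complex \<Rightarrow> complex) set" where
  "U_R_on K = {f. f holomorphic_on ball 0 1 \<and>
                  (\<forall>\<zeta>\<in>K. maximal_cluster (radial_cluster_set f \<zeta>))}"

definition U_R :: "(complex \<Rightarrow> complex) set" where
  "U_R = U_R_on (sphere 0 1)"

definition Bloch :: "(complex \<Rightarrow> complex) set" where
  "Bloch = {f. f holomorphic_on ball 0 1 \<and>
               bdd_above ((\<lambda>z. (1 - (cmod z)\<^sup>2) * cmod (deriv f z)) ` ball 0 1)}"

definition arc_null :: "complex set \<Rightarrow> bool" where
  "arc_null E \<longleftrightarrow> {t \<in> {0..<2*pi}. cis t \<in> E} \<in> null_sets lebesgue"

end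

theory Submission
  imports Defs "HOL-Complex_Analysis.Complex_Analysis" "HOL-Library.Real_Mod"
    "HOL-Real_Asymp.Real_Asymp"
begin

text \<open>
  (a) Transfer a Bloch function to the upper half-plane by \<open>g(w) = f(exp(iw))\<close> and let \<open>G' = g\<close>.
  The function \<open>\<Phi>(x, y) = G(x + iy) - iy g(x + iy)\<close> satisfies \<open>\<bar>\<partial>\<Phi>/\<partial>y\<bar> = y \<bar>g'\<bar> \<le> B\<close>, so it has
  boundary values \<open>\<phi>(x)\<close>, and \<open>(\<phi>(x + h) - \<phi>(x)) / h\<close> differs from \<open>g(x + ih)\<close> by at most \<open>4B\<close>.
  Subtracting a linear function from \<open>Re \<phi>\<close> and taking an interior maximum \<open>x\<close> shows that \<open>Re g\<close> is
  bounded above on the vertical ray over \<open>x\<close>, i.e. \<open>Re f\<close> is bounded above on some radius.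

  (b) Take \<open>f(z) = \<Sum> a\<^sub>k z^(n\<^sub>k)\<close> with \<open>a\<^sub>k = 1 / \<surd>(k + 1)\<close> and \<open>n\<^sub>k = (k + 2)!\<close>. On suitable circles \<open>f\<close> is
  uniformly close to its partial sums on the unit circle, and these are close to a random walk: the
  mixed-radix digits of the angle are independent, and the \<open>k\<close>-th one determines the \<open>k\<close>-th term up to
  an error \<open>O(a\<^sub>k n\<^sub>k / n\<^sub>k\<^sub>+\<^sub>1)\<close>. As \<open>\<Sum> a\<^sub>k\<^sup>2 = \<infinity>\<close>, the walk leaves every bounded annulus, and as \<open>ln \<bar>z\<bar>\<close>
  is harmonic, it leaves an annulus with a large outer radius most likely through the inner circle.
  Hence almost surely it visits every disc infinitely often.
\<close>

section \<open>Bloch functions are one-sidedly bounded on some radius\<close>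

lemma half_plane_bloch_ray_bounded_above:
  fixes g g' :: "complex \<Rightarrow> complex"
  assumes der: "\<And>w. Im w > 0 \<Longrightarrow> (g has_field_derivative g' w) (at w)"
    and bloch: "\<And>w. Im w > 0 \<Longrightarrow> Im w * cmod (g' w) \<le> B"
  obtains x C \<delta> where "\<delta> > 0" "\<And>y. 0 < y \<Longrightarrow> y \<le> \<delta> \<Longrightarrow> Re (g (Complex x y)) \<le> C"
proof -
  let ?H = "{w. 0 < Im w}"
  have "open ?H" "convex ?H"
    by (auto simp: open_halfspace_Im_gt convex_halfspace_Im_gt)
  moreover have "g holomorphic_on ?H"
    using der by (auto simp: holomorphic_on_def field_differentiable_def
        intro: has_field_derivative_at_within)
  ultimately obtain G where "\<And>w. w \<in> ?H \<Longrightarrow> (G has_field_derivative g w) (at w within ?H)"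
    using holomorphic_convex_primitive' by blast
  then have G: "(G has_field_derivative g w) (at w)" if "Im w > 0" for w
    using that \<open>open ?H\<close> at_within_open[of w ?H] by fastforce
  have B0: "B \<ge> 0"
    using order_trans[OF norm_ge_zero bloch[of \<i>, simplified]] .
  define \<Phi> where "\<Phi> x y = G (Complex x y) - Complex 0 y * g (Complex x y)" for x y
  have Im_seg: "Im w \<ge> h" if "w \<in> closed_segment u v" "Im u \<ge> h" "Im v \<ge> h" for u v w h
  proof -
    have "closed_segment u v \<subseteq> {w. Im w \<ge> h}"
      by (rule closed_segment_subset) (use that in \<open>auto simp: convex_halfspace_Im_ge\<close>)
    with that show ?thesis by auto
  qed
  have vert: "cmod (\<Phi> x y - \<Phi> x y') \<le> B * \<bar>y - y'\<bar>" if "y > 0" "y' > 0" for x y y'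
  proof -
    let ?S = "closed_segment (Complex x y) (Complex x y')"
    have Re_S: "Re w = x" if "w \<in> ?S" for w
      using that by (auto simp: closed_segment_def) (simp add: algebra_simps)
    have pos: "Im w > 0" if "w \<in> ?S" for w
      using Im_seg[OF that, of "min y y'"] \<open>y > 0\<close> \<open>y' > 0\<close> by auto
    \<comment> \<open>On the vertical line \<open>Re w = x\<close> the map
      \<open>G w - (w - x) * g w\<close> agrees with \<open>\<Phi> x\<close> and is moreover
      holomorphic. Its derivative \<open>- (w - x) * g' w\<close> has modulus
      \<open>Im w * cmod (g' w) \<le> B\<close> there, so the complex mean value inequality
      applies.\<close>
    have "cmod ((G (Complex x y) - (Complex x y - of_real x) * g (Complex x y))
              - (G (Complex x y') - (Complex x y' - of_real x) * g (Complex x y')))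
          \<le> B * cmod (Complex x y - Complex x y')"
    proof (rule field_differentiable_bound[where S = ?S
          and f = "\<lambda>w. G w - (w - of_real x) * g w" and f' = "\<lambda>w. - (w - of_real x) * g' w"])
      fix w assume w: "w \<in> ?S"
      show "((\<lambda>w. G w - (w - of_real x) * g w) has_field_derivative - (w - of_real x) * g' w)
              (at w within ?S)"
        by (rule has_field_derivative_at_within)
          (auto intro!: derivative_eq_intros G der pos[OF w] simp: algebra_simps)
      have "cmod (w - of_real x) = Im w"
        using Re_S[OF w] pos[OF w] by (simp add: cmod_def)
      then show "cmod (- (w - of_real x) * g' w) \<le> B"
        using bloch[OF pos[OF w]] by (simp add: norm_mult norm_minus_commute)
    qed auto
    moreover have "Complex x y - of_real x = Complex 0 y" "Complex x y' - of_real x = Complex 0 y'"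
      by (auto simp: complex_eq_iff)
    moreover have "cmod (Complex x y - Complex x y') = \<bar>y - y'\<bar>"
      by (simp add: cmod_def)
    ultimately show ?thesis by (simp add: \<Phi>_def)
  qed
  \<comment> \<open>At height \<open>h\<close> the Bloch condition bounds \<open>g'\<close> by
    \<open>B / h\<close>, so \<open>g\<close> varies by at most \<open>B\<close> over a segment of
    length \<open>h\<close>. Linearising \<open>G\<close> costs \<open>B * h\<close>, and the change
    of the correction term costs another \<open>B * h\<close>.\<close>
  have horiz: "cmod (\<Phi> (x + h) h - \<Phi> x h - of_real h * g (Complex x h)) \<le> 2 * B * h"
    if h: "h > 0" for x h
  proof -
    let ?a = "Complex x h" and ?b = "Complex (x + h) h"
    let ?S = "closed_segment ?a ?b"
    have imS: "Im w \<ge> h" if "w \<in> ?S" for w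
      using Im_seg[OF that, of h] by auto
    have ab: "?b - ?a = of_real h" by (simp add: complex_eq_iff)
    have nS: "cmod (w - ?a) \<le> h" if "w \<in> ?S" for w
      using segment_bound(1)[OF that] h by (simp add: ab)
    have g'S: "cmod (g' w) \<le> B / h" if "w \<in> ?S" for w
    proof -
      have "h * cmod (g' w) \<le> Im w * cmod (g' w)"
        using imS[OF that] by (simp add: mult_right_mono)
      also have "\<dots> \<le> B" using imS[OF that] h by (intro bloch) auto
      finally show ?thesis using h by (simp add: field_simps)
    qed
    have gS: "cmod (g w - g ?a) \<le> B" if "w \<in> ?S" for w
    proof -
      have "cmod (g w - g ?a) \<le> B / h * cmod (w - ?a)"
      proof (rule field_differentiable_bound[where S = ?S and f = g and f' = g'])
        show "(g has_field_derivative g' z) (at z within ?S)" if "z \<in> ?S" for z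
          using imS[OF that] h by (auto intro: has_field_derivative_at_within[OF der])
      qed (simp_all add: that g'S)
      also have "\<dots> \<le> B / h * h"
        using nS[OF that] B0 h by (intro mult_left_mono) auto
      finally show ?thesis using h by simp
    qed
    have "cmod ((G ?b - g ?a * ?b) - (G ?a - g ?a * ?a)) \<le> B * cmod (?b - ?a)"
    proof (rule field_differentiable_bound[where S = ?S and f = "\<lambda>w. G w - g ?a * w" and f' = "\<lambda>w. g w - g ?a"])
      show "((\<lambda>w. G w - g ?a * w) has_field_derivative g z - g ?a) (at z within ?S)"
        if "z \<in> ?S" for z
        by (rule has_field_derivative_at_within) (use imS[OF that] h in
          \<open>auto intro!: derivative_eq_intros G\<close>)
    qed (simp_all add: gS)
    moreover have "(G ?b - g ?a * ?b) - (G ?a - g ?a * ?a) = G ?b - G ?a - of_real h * g ?a"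
      unfolding ab[symmetric] by (simp only: algebra_simps)
    ultimately have 1: "cmod (G ?b - G ?a - of_real h * g ?a) \<le> B * h"
      using h unfolding ab by simp
    have "cmod (Complex 0 h) = h" using h by (simp add: cmod_def)
    then have 2: "cmod (Complex 0 h * (g ?b - g ?a)) \<le> B * h"
      using gS[of ?b] h by (simp only: norm_mult) (simp add: mult.commute mult_right_mono)
    have "\<Phi> (x + h) h - \<Phi> x h - of_real h * g (Complex x h) =
        (G ?b - G ?a - of_real h * g ?a) - Complex 0 h * (g ?b - g ?a)"
      by (simp add: \<Phi>_def algebra_simps)
    then have "cmod (\<Phi> (x + h) h - \<Phi> x h - of_real h * g ?a) \<le>
        cmod (G ?b - G ?a - of_real h * g ?a) + cmod (Complex 0 h * (g ?b - g ?a))"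
      by (simp only: norm_triangle_ineq4)
    with 1 2 show ?thesis by linarith
  qed
  \<comment> \<open>By \<open>vert\<close> the convergence is uniform in \<open>x\<close>, so that
    the boundary function inherits continuity. Dividing by \<open>B + 1\<close> covers the case
    \<open>B = 0\<close>.\<close>
  have "uniformly_convergent_on UNIV (\<lambda>n x. \<Phi> x (inverse (real (Suc n))))"
  proof (intro Cauchy_uniformly_convergent uniformly_Cauchy_onI')
    fix e :: real assume "e > 0"
    obtain M where M: "inverse (real (Suc M)) < e / (B + 1)"
      using reals_Archimedean[of "e / (B + 1)"] \<open>e > 0\<close> B0 by auto
    show "\<exists>M. \<forall>x\<in>UNIV. \<forall>m\<ge>M. \<forall>n>m. dist (\<Phi> x (inverse (real (Suc m)))) (\<Phi> x (inverse (real (Suc n)))) < e"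
    proof (intro exI allI impI ballI)
      fix x m n assume mn: "M \<le> m" "m < (n::nat)"
      let ?m = "inverse (real (Suc m))" and ?n = "inverse (real (Suc n))"
      have "?n \<le> ?m" "?m \<le> inverse (real (Suc M))" "?n > 0"
        using mn by (auto intro!: le_imp_inverse_le)
      then have "\<bar>?m - ?n\<bar> < e / (B + 1)" using M by linarith
      moreover have "cmod (\<Phi> x ?m - \<Phi> x ?n) \<le> B * \<bar>?m - ?n\<bar>" by (rule vert) auto
      moreover have "B * \<bar>?m - ?n\<bar> \<le> (B + 1) * \<bar>?m - ?n\<bar>" by (intro mult_right_mono) auto
      moreover have "(B + 1) * \<bar>?m - ?n\<bar> < e"
        using calculation(1) B0 by (simp only: less_divide_eq) (simp add: mult.commute)
      ultimately show "dist (\<Phi> x ?m) (\<Phi> x ?n) < e"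
        unfolding dist_norm by linarith
    qed
  qed
  then obtain \<phi> where \<phi>: "uniform_limit UNIV (\<lambda>n x. \<Phi> x (inverse (real (Suc n)))) \<phi> sequentially"
    by (auto simp: uniformly_convergent_on_def)
  have \<phi>_bound: "cmod (\<phi> x - \<Phi> x h) \<le> B * h" if h: "h > 0" for x h
  proof (rule tendsto_upperbound)
    show "(\<lambda>n. cmod (\<Phi> x (inverse (real (Suc n))) - \<Phi> x h)) \<longlonglongrightarrow> cmod (\<phi> x - \<Phi> x h)"
      by (intro tendsto_intros tendsto_uniform_limitI[OF \<phi>]) simp
    have "eventually (\<lambda>n. inverse (real (Suc n)) < h) sequentially"
      using LIMSEQ_inverse_real_of_nat h by (rule order_tendstoD)
    then show "\<forall>\<^sub>F n in sequentially. cmod (\<Phi> x (inverse (real (Suc n))) - \<Phi> x h) \<le> B * h"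
    proof eventually_elim
      case (elim n)
      have "cmod (\<Phi> x (inverse (real (Suc n))) - \<Phi> x h) \<le> B * \<bar>inverse (real (Suc n)) - h\<bar>"
        by (rule vert) (use h in auto)
      also have "\<dots> \<le> B * h"
        using elim B0 by (intro mult_left_mono) auto
      finally show ?case .
    qed
  qed auto
  have step: "cmod (\<phi> (x + h) - \<phi> x - of_real h * g (Complex x h)) \<le> 4 * B * h" if "h > 0" for x h
  proof -
    define u v w where "u = \<phi> (x + h) - \<Phi> (x + h) h" and "v = \<phi> x - \<Phi> x h"
      and "w = \<Phi> (x + h) h - \<Phi> x h - of_real h * g (Complex x h)"
    have "cmod u \<le> B * h" "cmod v \<le> B * h" "cmod w \<le> 2 * B * h"
      unfolding u_def v_def w_def using that by (intro \<phi>_bound horiz; simp)+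
    moreover have "\<phi> (x + h) - \<phi> x - of_real h * g (Complex x h) = u - v + w"
      by (simp add: u_def v_def w_def)
    ultimately show ?thesis
      using norm_triangle_ineq[of "u - v" w] norm_triangle_ineq4[of u v] by simp
  qed
  have contg: "continuous (at w) g" "continuous (at w) G" if "Im w > 0" for w
    using der[OF that] G[OF that] by (auto intro: DERIV_isCont)
  have "continuous_on UNIV \<phi>"
  proof (rule uniform_limit_theorem[OF _ \<phi>])
    have "continuous_on UNIV (\<lambda>x. \<Phi> x y)" if "y > 0" for y
    proof -
      have "continuous_on UNIV (\<lambda>x. Complex x y)"
        unfolding Complex_eq by (intro continuous_intros)
      moreover have "continuous_on ?H g" "continuous_on ?H G"
        using contg by (simp_all add: continuous_at_imp_continuous_on)
      ultimately have "continuous_on UNIV (\<lambda>x. g (Complex x y))" "continuous_on UNIV (\<lambda>x. G (Complex x y))"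
        using that by (auto elim: continuous_on_compose2)
      then show ?thesis
        unfolding \<Phi>_def by (intro continuous_intros)
    qed
    then show "\<forall>\<^sub>F n in sequentially. continuous_on UNIV (\<lambda>x. \<Phi> x (inverse (real (Suc n))))"
      by simp
  qed auto
  \<comment> \<open>Subtracting the chord makes \<open>\<psi>\<close> equal at both ends, so its
    maximum over \<open>{0..1}\<close> is also attained at some point other than 1. From there all
    increments to the right of length at most \<open>1 - x0\<close> are controlled, and these are
    the ones that \<open>step\<close> compares with \<open>g\<close>.\<close>
  define slope where "slope = Re (\<phi> 1) - Re (\<phi> 0)"
  define \<psi> where "\<psi> x = Re (\<phi> x) - slope * x" for x
  have "continuous_on {0..1} \<psi>"
    unfolding \<psi>_def using \<open>continuous_on UNIV \<phi>\<close> 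
    by (intro continuous_intros) (auto intro: continuous_on_subset)
  then obtain x1 where x1: "x1 \<in> {0..1}" "\<And>x. x \<in> {0..1} \<Longrightarrow> \<psi> x \<le> \<psi> x1"
    using continuous_attains_sup[of "{0..1::real}" \<psi>] by auto
  have "\<psi> 0 = \<psi> 1" by (simp add: \<psi>_def slope_def)
  then obtain x0 where x0: "0 \<le> x0" "x0 < 1" "\<And>x. x \<in> {0..1} \<Longrightarrow> \<psi> x \<le> \<psi> x0"
    using x1 by (cases "x1 = 1") (use that[of 0] that[of x1] in auto)
  show thesis
  proof (rule that[of "1 - x0" x0 "slope + 4 * B"])
    fix y assume y: "0 < y" "y \<le> 1 - x0"
    have "Re (\<phi> (x0 + y)) - Re (\<phi> x0) \<le> slope * y"
      using x0(3)[of "x0 + y"] x0 y by (simp add: \<psi>_def algebra_simps)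
    moreover have "\<bar>Re (\<phi> (x0 + y) - \<phi> x0 - of_real y * g (Complex x0 y))\<bar> \<le> 4 * B * y"
      using step[OF y(1)] abs_Re_le_cmod order_trans by blast
    ultimately have "y * Re (g (Complex x0 y)) \<le> y * (slope + 4 * B)"
      by (simp add: abs_le_iff algebra_simps)
    then show "Re (g (Complex x0 y)) \<le> slope + 4 * B" using y by simp
  qed (use x0 in auto)
qed

text \<open>The map \<open>exp (\<i> * w)\<close> carries vertical rays to radii, with
  \<open>s = exp (-y)\<close>. The Bloch condition becomes the half-plane one because
  \<open>y * exp (-y) \<le> 1 - exp (-y) \<le> 1 - exp (-2 * y)\<close>.\<close>

lemma Bloch_ray_bounded_above:
  assumes "f \<in> Bloch"
  obtains \<zeta> C r where "\<zeta> \<in> sphere 0 1" "r < 1"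
    "\<And>s. r \<le> s \<Longrightarrow> s < 1 \<Longrightarrow> Re (f (of_real s * \<zeta>)) \<le> C"
proof -
  from assms have hol: "f holomorphic_on ball 0 1"
    and "bdd_above ((\<lambda>z. (1 - (cmod z)\<^sup>2) * cmod (deriv f z)) ` ball 0 1)"
    by (auto simp: Bloch_def)
  then obtain B where "\<forall>z\<in>ball 0 1. (1 - (cmod z)\<^sup>2) * cmod (deriv f z) \<le> B"
    by (auto simp: bdd_above_def)
  then have B: "(1 - (cmod z)\<^sup>2) * cmod (deriv f z) \<le> B" if "cmod z < 1" for z
    using that by simp
  define g where "g w = f (exp (\<i> * w))" for w
  define g' where "g' w = deriv f (exp (\<i> * w)) * (exp (\<i> * w) * \<i>)" for w
  have in_disc: "exp (\<i> * w) \<in> ball 0 1" if "Im w > 0" for w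
    using that by simp
  have g_deriv: "(g has_field_derivative g' w) (at w)"
    and g_bloch: "Im w * cmod (g' w) \<le> B" if w: "Im w > 0" for w
  proof -
    have "(f has_field_derivative deriv f (exp (\<i> * w))) (at (exp (\<i> * w)))"
      using hol in_disc[OF w] by (intro holomorphic_derivI[of _ "ball 0 1"]) auto
    then show "(g has_field_derivative g' w) (at w)"
      unfolding g_def g'_def
      by (rule DERIV_chain2) (rule derivative_eq_intros refl | simp)+
    define y where "y = Im w"
    have y: "y > 0" using w by (simp add: y_def)
    have n: "cmod (exp (\<i> * w)) = exp (-y)" by (simp add: y_def)
    have "1 + y \<le> exp y" by (rule exp_ge_add_one_self)
    then have "(1 + y) * exp (-y) \<le> exp y * exp (-y)" by (intro mult_right_mono) auto
    then have "y * exp (-y) \<le> 1 - exp (-y)" by (simp add: exp_minus algebra_simps)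
    moreover have "(exp (-y))\<^sup>2 \<le> exp (-y)"
      using y by (simp add: power2_eq_square mult_le_cancel_left1)
    ultimately have "y * exp (-y) \<le> 1 - (exp (-y))\<^sup>2" by linarith
    then have "y * exp (-y) * cmod (deriv f (exp (\<i> * w))) \<le> (1 - (exp (-y))\<^sup>2) * cmod (deriv f (exp (\<i> * w)))"
      by (intro mult_right_mono) auto
    also have "\<dots> \<le> B" using B[of "exp (\<i> * w)", unfolded n] y by simp
    finally show "Im w * cmod (g' w) \<le> B"
      using n by (simp add: g'_def norm_mult y_def ac_simps)
  qed
  from half_plane_bloch_ray_bounded_above[of g g' B, OF g_deriv g_bloch]
  obtain x C and \<delta> :: real
    where xC: "\<delta> > 0" "\<And>y. 0 < y \<Longrightarrow> y \<le> \<delta> \<Longrightarrow> Re (g (Complex x y)) \<le> C"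
    by metis
  show thesis
  proof (rule that[of "cis x" "exp (-\<delta>)"])
    show "exp (-\<delta>) < 1" using xC by simp
    fix s assume s: "exp (-\<delta>) \<le> s" "s < 1"
    have s0: "s > 0" using s(1) exp_gt_zero[of "-\<delta>"] by linarith
    have "-\<delta> \<le> ln s" using s s0 by (simp add: ln_ge_iff)
    moreover have "ln s < 0" using s s0 by simp
    ultimately have "Re (g (Complex x (- ln s))) \<le> C" by (intro xC) auto
    moreover have "\<i> * Complex x (- ln s) = of_real (ln s) + \<i> * of_real x"
      by (simp add: complex_eq_iff)
    then have "exp (\<i> * Complex x (- ln s)) = of_real s * cis x"
      using s0 by (simp only: exp_add exp_of_real cis_conv_exp[symmetric] exp_ln)
    ultimately show "Re (f (of_real s * cis x)) \<le> C" by (simp add: g_def)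
  qed auto
qed

lemma U_R_Bloch_disjoint: "U_R \<inter> Bloch = {}"
proof -
  have False if "f \<in> U_R" "f \<in> Bloch" for f
  proof -
    obtain \<zeta> C r where \<zeta>: "\<zeta> \<in> sphere 0 1" and r: "r < 1"
      and bound: "\<And>s. r \<le> s \<Longrightarrow> s < 1 \<Longrightarrow> Re (f (of_real s * \<zeta>)) \<le> C"
      by (rule Bloch_ray_bounded_above[OF \<open>f \<in> Bloch\<close>]) metis
    \<comment> \<open>Maximality makes every finite value a cluster value, even one with real part
      above \<open>C\<close>, which the bound on this radius excludes.\<close>
    have "Some (complex_of_real (C + 1)) \<in> radial_cluster_set f \<zeta>"
      using \<open>f \<in> U_R\<close> \<zeta> unfolding U_R_def U_R_on_def maximal_cluster_def by auto
    then obtain s where s: "radial_seq s" "(\<lambda>n. f (of_real (s n) * \<zeta>)) \<longlonglongrightarrow> of_real (C + 1)"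
      unfolding radial_cluster_set_def by (auto split: if_splits)
    have "eventually (\<lambda>n. r < s n) sequentially"
      using s(1) r unfolding radial_seq_def by (metis order_tendstoD(1))
    then have "eventually (\<lambda>n. Re (f (of_real (s n) * \<zeta>)) \<le> C) sequentially"
      by (rule eventually_mono) (use s(1) bound in \<open>simp add: radial_seq_def\<close>)
    then have "Re (complex_of_real (C + 1)) \<le> C"
      by (intro tendsto_upperbound[OF tendsto_Re[OF s(2)]]) auto
    then show False by simp
  qed
  then show ?thesis by auto
qed

section \<open>Averages over roots of unity\<close>

lemma norm_cis_diff_le: "cmod (cis x - cis y) \<le> \<bar>x - y\<bar>"
proof -
  have "cmod (cis x - cis y) = cmod (cis y * (cis (x - y) - 1))"
    by (simp add: right_diff_distrib cis_mult)
  also have "\<dots> = 2 * \<bar>sin ((x - y) / 2)\<bar>"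
    by (simp add: norm_mult cis_conv_exp dist_exp_i_1 del: of_real_diff)
  also have "\<dots> \<le> \<bar>x - y\<bar>"
    using abs_sin_x_le_abs_x[of "(x - y) / 2"] by simp
  finally show ?thesis .
qed

text \<open>The sum is geometric, and its ratio is a nontrivial \<open>N\<close>-th root of unity.
  The cases \<open>m = 1\<close> and \<open>m = 2\<close> are applied below; the second one accounts
  for the condition \<open>N \<ge> 3\<close> there.\<close>

lemma sum_cis_roots_of_unity:
  assumes "0 < m" "m < N"
  shows "(\<Sum>d<N. cis (2 * pi * real d / real N) ^ m) = 0"
proof -
  let ?w = "cis (2 * pi * real m / real N)"
  have eq: "cis (2 * pi * real d / real N) ^ m = ?w ^ d" for d
    unfolding Complex.DeMoivre by (rule arg_cong[of _ _ cis]) simp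
  have "?w \<noteq> 1"
  proof
    assume "?w = 1"
    then obtain i :: int where "2 * pi * real m / real N = of_int i * (2 * pi)"
      by (auto simp: cis_eq_1_iff)
    then have "real m = of_int i * real N" using assms by (simp add: field_simps)
    then have i: "int m = i * int N" by (metis of_int_eq_iff of_int_mult of_int_of_nat_eq)
    then have "int N dvd int m" by simp
    then show False using assms by (simp add: nat_dvd_not_less)
  qed
  moreover have "?w ^ N = 1"
    using assms by (simp add: Complex.DeMoivre)
  ultimately show ?thesis
    unfolding eq by (simp add: geometric_sum)
qed

text \<open>The difference of the two sides has derivative \<open>t ^ 3 / (1 + t)\<close>, which has
  the sign of \<open>t\<close>, so its minimum is its value 0 at the origin.\<close>

lemma ln_one_plus_le_cubic:
  fixes x :: real
  assumes "x > -1"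
  shows "ln (1 + x) \<le> x - x\<^sup>2 / 2 + x ^ 3 / 3"
proof -
  define h where "h x = x - x\<^sup>2 / 2 + x ^ 3 / 3 - ln (1 + x)" for x :: real
  have deriv: "(h has_real_derivative t ^ 3 / (1 + t)) (at t)" if "t > -1" for t
    unfolding h_def using that
    by (auto intro!: derivative_eq_intros simp: field_simps power2_eq_square power3_eq_cube)
  have "h 0 \<le> h x"
  proof (cases "x \<ge> 0")
    case True
    show ?thesis
    proof (rule DERIV_nonneg_imp_nondecreasing[OF True])
      fix t assume "0 \<le> t" "t \<le> x"
      then show "\<exists>y. DERIV h t :> y \<and> y \<ge> 0" using deriv[of t] by force
    qed
  next
    case False
    show ?thesis
    proof (rule DERIV_nonpos_imp_nonincreasing[of x 0])
      fix t assume t: "x \<le> t" "t \<le> 0"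
      have "t ^ 3 \<le> 0" using t by (simp add: power_le_zero_eq)
      then have "t ^ 3 / (1 + t) \<le> 0" using t assms by (simp add: divide_nonpos_pos)
      then show "\<exists>y. DERIV h t :> y \<and> y \<le> 0" using deriv[of t] t assms by force
    qed (use False in auto)
  qed
  then show ?thesis by (simp add: h_def)
qed

text \<open>This is half of the cubic bound at \<open>x = (cmod (1 + z))\<^sup>2 - 1\<close>. The
  terms are arranged so that all but the last cancel when \<open>z\<close> runs over a multiple of
  the roots of unity. The constant 5 rounds up \<open>9 / 2\<close>, which comes from
  \<open>x \<le> 3 * cmod z\<close>.\<close>

lemma ln_norm_one_plus_le:
  fixes z :: complex
  assumes "cmod z \<le> 1 / 2"
  shows "ln (cmod (1 + z)) \<le> Re z * (1 - (cmod z)\<^sup>2) - Re (z\<^sup>2) / 2 + 5 * cmod z ^ 3"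
proof -
  define u \<rho> where "u = Re z" and "\<rho> = cmod z"
  define x where "x = 2 * u + \<rho>\<^sup>2"
  have \<rho>: "0 \<le> \<rho>" "\<rho> \<le> 1 / 2" using assms by (auto simp: \<rho>_def)
  have u: "\<bar>u\<bar> \<le> \<rho>" unfolding u_def \<rho>_def by (rule abs_Re_le_cmod)
  have z2: "Re (z\<^sup>2) = 2 * u\<^sup>2 - \<rho>\<^sup>2"
    by (simp add: u_def \<rho>_def cmod_power2) (simp add: power2_eq_square)
  have sq: "(cmod (1 + z))\<^sup>2 = 1 + x"
    unfolding x_def u_def \<rho>_def cmod_power2 by (simp add: power2_eq_square algebra_simps)
  have "1 + z \<noteq> 0"
  proof
    assume "1 + z = 0"
    then have "z = -1" by (simp add: add_eq_0_iff)
    then show False using assms by simp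
  qed
  then have pos: "cmod (1 + z) > 0" by simp
  then have "0 < (cmod (1 + z))\<^sup>2" by (rule zero_less_power)
  then have "x > -1" unfolding sq by simp
  then have "ln (1 + x) \<le> x - x\<^sup>2 / 2 + x ^ 3 / 3" by (rule ln_one_plus_le_cubic)
  also have "x ^ 3 \<le> (3 * \<rho>) ^ 3"
  proof (rule power_mono_odd)
    have "\<rho>\<^sup>2 \<le> \<rho>" using \<rho> by (simp add: power2_eq_square mult_left_le)
    then show "x \<le> 3 * \<rho>" using u by (simp add: x_def)
  qed simp
  also have "x - x\<^sup>2 / 2 = 2 * (u * (1 - \<rho>\<^sup>2)) - (2 * u\<^sup>2 - \<rho>\<^sup>2) - \<rho> ^ 4 / 2"
    by (simp add: x_def power2_eq_square power4_eq_xxxx field_simps)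
  also have "(3 * \<rho>) ^ 3 = 27 * \<rho> ^ 3" by (simp add: power_mult_distrib)
  finally have "ln (1 + x) \<le> 2 * (u * (1 - \<rho>\<^sup>2)) - (2 * u\<^sup>2 - \<rho>\<^sup>2) - \<rho> ^ 4 / 2 + 27 * \<rho> ^ 3 / 3"
    by simp
  moreover have "\<rho> ^ 4 \<ge> 0" "\<rho> ^ 3 \<ge> 0" using \<rho> by simp_all
  moreover have "ln (1 + x) = 2 * ln (cmod (1 + z))"
    unfolding sq[symmetric] using pos by (simp add: ln_realpow)
  ultimately show ?thesis unfolding z2 u_def[symmetric] \<rho>_def[symmetric] by argo
qed

text \<open>Expanding the square leaves a cross term linear in the root of unity, which sums to
  zero.\<close>

lemma mean_norm_sq_roots:
  assumes "N \<ge> 2"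
  shows "(\<Sum>d<N. (cmod (s + of_real a * cis (2 * pi * real d / real N)))\<^sup>2)
    = real N * ((cmod s)\<^sup>2 + a\<^sup>2)"
proof -
  have eq: "(cmod (s + of_real a * w))\<^sup>2 = (cmod s)\<^sup>2 + a\<^sup>2 + Re (2 * a * cnj s * w)"
    if "cmod w = 1" for w
  proof -
    have "(Re w)\<^sup>2 + (Im w)\<^sup>2 = 1" using that by (metis cmod_power2 one_power2)
    then have "a\<^sup>2 = a\<^sup>2 * ((Re w)\<^sup>2 + (Im w)\<^sup>2)" by simp
    moreover have "(cmod (s + of_real a * w))\<^sup>2
        = (cmod s)\<^sup>2 + a\<^sup>2 * ((Re w)\<^sup>2 + (Im w)\<^sup>2) + Re (2 * a * cnj s * w)"
      unfolding cmod_power2 by (simp add: power2_eq_square algebra_simps)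
    ultimately show ?thesis by simp
  qed
  have "(\<Sum>d<N. Re (2 * a * cnj s * cis (2 * pi * real d / real N)))
     = Re (2 * a * cnj s * (\<Sum>d<N. cis (2 * pi * real d / real N)))"
    by (simp only: sum_distrib_left Re_sum)
  also have "\<dots> = 0" using sum_cis_roots_of_unity[of 1 N] assms by simp
  finally show ?thesis by (simp add: eq sum.distrib)
qed

text \<open>After dividing by \<open>s\<close>, the first and second powers of the
  \<open>z d\<close> sum to zero and only the cubic error remains: a discrete form of the mean value
  property of \<open>ln (cmod s)\<close>.\<close>

lemma mean_ln_norm_roots_le:
  assumes "N \<ge> 3" "s \<noteq> 0" "0 \<le> a" "a \<le> cmod s / 2"
  shows "(\<Sum>d<N. ln (cmod (s + of_real a * cis (2 * pi * real d / real N))))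
    \<le> real N * (ln (cmod s) + 5 * (a / cmod s) ^ 3)"
proof -
  define \<rho> where "\<rho> = a / cmod s"
  define z where "z d = of_real a / s * cis (2 * pi * real d / real N)" for d
  have nz: "cmod (z d) = \<rho>" for d
    using assms by (simp add: z_def \<rho>_def norm_mult norm_divide)
  have \<rho>: "\<rho> \<le> 1 / 2" using assms by (simp add: \<rho>_def field_simps)
  have ne: "1 + z d \<noteq> 0" for d
  proof
    assume "1 + z d = 0"
    then have "z d = -1" by (simp add: add_eq_0_iff)
    then show False using \<rho> nz[of d] by simp
  qed
  have "ln (cmod (s + of_real a * cis (2 * pi * real d / real N))) = ln (cmod s) + ln (cmod (1 + z d))" for d
  proof -
    have "s + of_real a * cis (2 * pi * real d / real N) = s * (1 + z d)"
      using assms by (simp add: z_def field_simps)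
    then show ?thesis using assms ne by (simp add: norm_mult ln_mult)
  qed
  then have "(\<Sum>d<N. ln (cmod (s + of_real a * cis (2 * pi * real d / real N))))
     = real N * ln (cmod s) + (\<Sum>d<N. ln (cmod (1 + z d)))"
    by (simp add: sum.distrib)
  also have "(\<Sum>d<N. ln (cmod (1 + z d))) \<le> (\<Sum>d<N. Re (z d) * (1 - \<rho>\<^sup>2) - Re ((z d)\<^sup>2) / 2 + 5 * \<rho> ^ 3)"
    using ln_norm_one_plus_le[of "z _"] \<rho> nz by (intro sum_mono) (metis)
  also have "\<dots> = Re (\<Sum>d<N. z d) * (1 - \<rho>\<^sup>2) - Re (\<Sum>d<N. (z d)\<^sup>2) / 2 + real N * (5 * \<rho> ^ 3)"
    by (simp add: sum.distrib sum_subtractf sum_distrib_right sum_divide_distrib)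
  also have "(\<Sum>d<N. z d) = 0"
    using sum_cis_roots_of_unity[of 1 N] assms unfolding z_def sum_distrib_left[symmetric] by simp
  also have "(\<Sum>d<N. (z d)\<^sup>2) = 0"
    using sum_cis_roots_of_unity[of 2 N] assms
    unfolding z_def power_mult_distrib sum_distrib_left[symmetric] by simp
  finally show ?thesis by (simp add: \<rho>_def algebra_simps)
qed

section \<open>Recurrence of the random walk\<close>

text \<open>Each series condition feeds one estimate. Divergence of the squares drives the walk out
  of every bounded annulus, convergence of the cubes bounds the total drift of the logarithm, and
  convergence of \<open>a k / N k\<close> bounds the error of replacing exponentials by roots of
  unity.\<close>

locale lacunary =
  fixes a :: "nat \<Rightarrow> real" and N n :: "nat \<Rightarrow> nat"
  assumes a_nonneg: "0 \<le> a k" and a_le_1: "a k \<le> 1" and a_lim: "a \<longlonglongrightarrow> 0"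
    and N_ge: "3 \<le> N k" and n_0: "0 < n 0" and n_Suc: "n (Suc k) = N k * n k"
    and a_sq: "\<not> summable (\<lambda>k. (a k)\<^sup>2)" and a_cube: "summable (\<lambda>k. a k ^ 3)"
    and a_over_N: "summable (\<lambda>k. a k / real (N k))"
begin

abbreviation unit_root :: "nat \<Rightarrow> nat \<Rightarrow> complex" where
  "unit_root k d \<equiv> cis (2 * pi * real d / real (N k))"

text \<open>\<open>miss \<epsilon> j k s\<close> is the probability that the walk started at \<open>s\<close>, whose \<open>i\<close>-th step is
  \<open>a i\<close> times a uniformly distributed \<open>N i\<close>-th root of unity, performs steps \<open>k, \<dots>, k + j - 1\<close>
  without entering the disc of radius \<open>\<epsilon>\<close>; \<open>stay \<epsilon> R j k s\<close> is the probability that it does so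
  without leaving the annulus.\<close>

primrec miss :: "real \<Rightarrow> nat \<Rightarrow> nat \<Rightarrow> complex \<Rightarrow> real" where
  "miss \<epsilon> 0 k s = (if cmod s < \<epsilon> then 0 else 1)"
| "miss \<epsilon> (Suc j) k s = (if cmod s < \<epsilon> then 0
     else (\<Sum>d<N k. miss \<epsilon> j (Suc k) (s + a k * unit_root k d)) / N k)"

primrec stay :: "real \<Rightarrow> real \<Rightarrow> nat \<Rightarrow> nat \<Rightarrow> complex \<Rightarrow> real" where
  "stay \<epsilon> R 0 k s = (if \<epsilon> \<le> cmod s \<and> cmod s \<le> R then 1 else 0)"
| "stay \<epsilon> R (Suc j) k s = (if \<epsilon> \<le> cmod s \<and> cmod s \<le> R
     then (\<Sum>d<N k. stay \<epsilon> R j (Suc k) (s + a k * unit_root k d)) / N k else 0)"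

lemma N_pos: "0 < N k"
  using N_ge[of k] by linarith

lemma mean_le:
  assumes "\<And>d. d < N k \<Longrightarrow> x d \<le> C"
  shows "(\<Sum>d<N k. x d) / real (N k) \<le> (C::real)"
proof -
  have "(\<Sum>d<N k. x d) \<le> (\<Sum>d<N k. C)" using assms by (intro sum_mono) auto
  then show ?thesis using N_pos[of k] by (simp add: field_simps)
qed

lemma miss_le_1: "miss \<epsilon> j k s \<le> 1"
  by (induction j arbitrary: k s) (auto intro!: mean_le)

lemma stay_nonneg: "0 \<le> stay \<epsilon> R j k s"
  by (induction j arbitrary: k s) (auto intro!: divide_nonneg_nonneg sum_nonneg)

lemma stay_le_1: "stay \<epsilon> R j k s \<le> 1"
  by (induction j arbitrary: k s) (auto intro!: mean_le)

text \<open>The second moment of the stopped walk grows by \<open>(a i)\<^sup>2\<close> for every step inside the annulus.\<close>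

lemma stay_second_moment:
  assumes "cmod s \<le> R + 1"
  shows "(cmod s)\<^sup>2 + (\<Sum>i<j. (a (k + i))\<^sup>2) * stay \<epsilon> R j k s \<le> (R + 1)\<^sup>2"
  using assms
proof (induction j arbitrary: k s)
  case 0
  then show ?case by (simp add: power_mono)
next
  case (Suc j)
  show ?case
  proof (cases "\<epsilon> \<le> cmod s \<and> cmod s \<le> R")
    case False
    then show ?thesis using Suc.prems by (auto simp: power_mono)
  next
    case True
    let ?s = "\<lambda>d. s + a k * unit_root k d"
    let ?\<sigma> = "\<Sum>i<j. (a (Suc k + i))\<^sup>2"
    \<comment> \<open>One step from inside the outer circle has length at most 1, whence the bound
      \<open>(R + 1)\<^sup>2\<close>.\<close>
    have "cmod (?s d) \<le> R + 1" for d
    proof -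
      have "cmod (?s d) \<le> cmod s + cmod (a k * unit_root k d)" by (rule norm_triangle_ineq)
      also have "\<dots> \<le> R + 1" using True a_nonneg[of k] a_le_1[of k] by (simp add: norm_mult)
      finally show ?thesis .
    qed
    then have "(\<Sum>d<N k. (cmod (?s d))\<^sup>2 + ?\<sigma> * stay \<epsilon> R j (Suc k) (?s d)) / N k \<le> (R + 1)\<^sup>2"
      by (intro mean_le Suc.IH)
    moreover have "(\<Sum>d<N k. (cmod (?s d))\<^sup>2 + ?\<sigma> * stay \<epsilon> R j (Suc k) (?s d)) / N k
        = (cmod s)\<^sup>2 + (a k)\<^sup>2 + ?\<sigma> * stay \<epsilon> R (Suc j) k s"
      using True mean_norm_sq_roots[of "N k" s "a k"] N_ge[of k]
      by (simp add: sum.distrib sum_distrib_left[symmetric] add_divide_distrib)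
    moreover have "(a k)\<^sup>2 * stay \<epsilon> R (Suc j) k s \<le> (a k)\<^sup>2"
      by (intro mult_left_le stay_le_1) simp
    moreover have "(\<Sum>i<Suc j. (a (k + i))\<^sup>2) * stay \<epsilon> R (Suc j) k s
        = (a k)\<^sup>2 * stay \<epsilon> R (Suc j) k s + ?\<sigma> * stay \<epsilon> R (Suc j) k s"
      by (subst sum.lessThan_Suc_shift) (simp add: distrib_right)
    ultimately show ?thesis by linarith
  qed
qed

text \<open>As \<open>ln \<bar>s\<bar>\<close> is nearly preserved by averaging over a step, the walk is unlikely to
  leave the annulus through a large outer circle.\<close>

lemma miss_le_stay:
  assumes \<epsilon>: "0 < \<epsilon>" and R: "\<epsilon> \<le> 2 * R" "0 < ln (2 * R / \<epsilon>)"
    and small: "\<And>i. k \<le> i \<Longrightarrow> a i \<le> \<epsilon> / 2"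
  shows "miss \<epsilon> j k s \<le> stay \<epsilon> R j k s
    + (max 0 (ln (2 * cmod s / \<epsilon>)) + (\<Sum>i<j. 5 / \<epsilon> ^ 3 * a (k + i) ^ 3)) / ln (2 * R / \<epsilon>)"
  using small
proof (induction j arbitrary: k s)
  case 0
  \<comment> \<open>The potential \<open>?l\<close> vanishes up to radius
    \<open>\<epsilon> / 2\<close> and equals \<open>?\<Lambda>\<close> at radius \<open>R\<close>.
    Outside the outer circle its quotient by \<open>?\<Lambda>\<close> is therefore at least 1 and
    dominates any probability.\<close>
  let ?\<Lambda> = "ln (2 * R / \<epsilon>)" and ?l = "\<lambda>s. max 0 (ln (2 * cmod s / \<epsilon>))"
  have "?\<Lambda> \<le> ?l s" if "cmod s > R" 
    using that R \<epsilon> by (intro max.coboundedI2 ln_mono divide_right_mono) auto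
  then have "1 \<le> ?l s / ?\<Lambda>" if "cmod s > R" using that R by simp
  then show ?case using R by auto
next
  case (Suc j)
  let ?\<Lambda> = "ln (2 * R / \<epsilon>)" and ?l = "\<lambda>s. max 0 (ln (2 * cmod s / \<epsilon>))"
  let ?e = "\<lambda>j k. \<Sum>i<j. 5 / \<epsilon> ^ 3 * a (k + i) ^ 3"
  have e: "?e j k \<ge> 0" for j k using a_nonneg \<epsilon> by (intro sum_nonneg) auto
  consider "cmod s < \<epsilon>" | "cmod s > R" | "\<epsilon> \<le> cmod s" "cmod s \<le> R" by linarith
  then show ?case
  proof cases
    case 1
    moreover have "0 \<le> (?l s + ?e (Suc j) k) / ?\<Lambda>"
      using e[of k "Suc j"] R by (simp del: sum.lessThan_Suc)
    ultimately show ?thesis using stay_nonneg[of \<epsilon> R "Suc j" k s] by simp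
  next
    case 2
    then have "?\<Lambda> \<le> ?l s"
      using R \<epsilon> by (intro max.coboundedI2 ln_mono divide_right_mono) auto
    then have "1 \<le> (?l s + ?e (Suc j) k) / ?\<Lambda>"
      using R e[of k "Suc j"] by (simp del: sum.lessThan_Suc)
    then show ?thesis
      using miss_le_1[of \<epsilon> "Suc j" k s] stay_nonneg[of \<epsilon> R "Suc j" k s] by linarith
  next
    case 3
    let ?s = "\<lambda>d. s + a k * unit_root k d"
    have s0: "0 < cmod s" using 3 \<epsilon> by linarith
    have ak: "0 \<le> a k" "a k \<le> \<epsilon> / 2" using Suc.prems a_nonneg by auto
    \<comment> \<open>From radius at least \<epsilon> a step of length at most
      \<open>\<epsilon> / 2\<close> ends at radius at least \<open>\<epsilon> / 2\<close>, where the
      truncation at 0 is inactive. Hence the mean estimate for the plain logarithm applies.\<close>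
    have l: "?l (?s d) = ln (cmod (?s d)) + ln (2 / \<epsilon>)" for d
    proof -
      have "cmod s \<le> cmod (?s d) + cmod (a k * unit_root k d)"
        using norm_triangle_ineq4[of "?s d" "a k * unit_root k d"] by simp
      then have "cmod (?s d) \<ge> \<epsilon> / 2" using 3 ak by (simp add: norm_mult)
      then have 1: "2 * cmod (?s d) / \<epsilon> \<ge> 1" and "cmod (?s d) > 0"
        using \<epsilon> by (simp only: le_divide_eq, simp, linarith)
      then have "ln (2 * cmod (?s d) / \<epsilon>) = ln (cmod (?s d)) + ln (2 / \<epsilon>)"
        using \<epsilon> by (simp add: ln_mult ln_div)
      then show ?thesis using ln_ge_zero[OF 1] by linarith
    qed
    have "(\<Sum>d<N k. ?l (?s d)) / N k \<le> ln (cmod s) + 5 * (a k / cmod s) ^ 3 + ln (2 / \<epsilon>)"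
    proof -
      have "(\<Sum>d<N k. ln (cmod (?s d))) \<le> real (N k) * (ln (cmod s) + 5 * (a k / cmod s) ^ 3)"
        using 3 \<epsilon> ak N_ge[of k] by (intro mean_ln_norm_roots_le) auto
      then show ?thesis using N_pos[of k] unfolding l by (simp add: sum.distrib field_simps)
    qed
    moreover have "(a k / cmod s) ^ 3 \<le> (a k / \<epsilon>) ^ 3"
      using 3 ak \<epsilon> s0 by (intro power_mono divide_left_mono) auto
    moreover have "ln (cmod s) + ln (2 / \<epsilon>) = ln (2 * cmod s / \<epsilon>)"
      using s0 \<epsilon> by (simp add: ln_mult ln_div)
    moreover have "\<dots> \<le> ?l s" by simp
    ultimately have mean_l: "(\<Sum>d<N k. ?l (?s d)) / N k \<le> ?l s + 5 / \<epsilon> ^ 3 * a k ^ 3"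
      by (simp add: power_divide) 
    have "miss \<epsilon> (Suc j) k s \<le> (\<Sum>d<N k. stay \<epsilon> R j (Suc k) (?s d)
        + (?l (?s d) + ?e j (Suc k)) / ?\<Lambda>) / N k"
      using 3 Suc.IH[of "Suc k"] Suc.prems by (simp add: sum_mono divide_right_mono)
    also have "\<dots> = stay \<epsilon> R (Suc j) k s + ((\<Sum>d<N k. ?l (?s d)) / N k + ?e j (Suc k)) / ?\<Lambda>"
      using 3 N_pos[of k] R
      by (simp add: sum.distrib add_divide_distrib sum_divide_distrib[symmetric])
    also have "\<dots> \<le> stay \<epsilon> R (Suc j) k s + (?l s + 5 / \<epsilon> ^ 3 * a k ^ 3 + ?e j (Suc k)) / ?\<Lambda>"
      using mean_l R by (intro add_left_mono divide_right_mono add_right_mono) auto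
    also have "?l s + 5 / \<epsilon> ^ 3 * a k ^ 3 + ?e j (Suc k) = ?l s + ?e (Suc j) k"
      by (subst sum.lessThan_Suc_shift) simp
    finally show ?thesis .
  qed
qed

text \<open>First \<open>R\<close> is taken so large that the logarithmic term is at most
  \<open>\<delta> / 2\<close>, then \<open>j\<close> so large that the second moment leaves at most
  \<open>\<delta> / 2\<close> for staying in the annulus. Both choices depend on the starting point
  only through \<open>S\<close>, so one \<open>j\<close> serves the whole disc.\<close>

lemma miss_small:
  assumes \<epsilon>: "0 < \<epsilon>" and small: "\<And>i. k \<le> i \<Longrightarrow> a i \<le> \<epsilon> / 2" and \<delta>: "0 < \<delta>"
  obtains j where "\<And>s. cmod s \<le> S \<Longrightarrow> miss \<epsilon> j k s \<le> \<delta>"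
proof -
  define T where "T = 5 / \<epsilon> ^ 3 * (\<Sum>i. a i ^ 3)"
  have T: "(\<Sum>i<j. 5 / \<epsilon> ^ 3 * a (k + i) ^ 3) \<le> T" for j
  proof -
    have "(\<Sum>i<j. a (k + i) ^ 3) = (\<Sum>i\<in>{k..<k + j}. a i ^ 3)"
      using sum.shift_bounds_nat_ivl[of "\<lambda>i. a i ^ 3" 0 k j] by (simp add: atLeast0LessThan add.commute)
    also have "\<dots> \<le> (\<Sum>i. a i ^ 3)"
      using a_nonneg by (intro sum_le_suminf a_cube) auto
    finally show ?thesis
      unfolding sum_distrib_left[symmetric] T_def using \<epsilon> by (intro mult_left_mono) auto
  qed
  define S' where "S' = max S \<epsilon>"
  define M where "M = ln (2 * S' / \<epsilon>) + T"
  have S': "S' \<ge> \<epsilon>" "S' \<ge> S" by (auto simp: S'_def)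
  define \<Lambda> where "\<Lambda> = max 1 (2 * M / \<delta>)"
  define R where "R = max S' (\<epsilon> / 2 * exp \<Lambda>)"
  have "2 * R / \<epsilon> \<ge> exp \<Lambda>" using \<epsilon> by (simp add: R_def field_simps)
  then have "ln (2 * R / \<epsilon>) \<ge> \<Lambda>" by (metis exp_gt_zero less_le_trans ln_ge_iff)
  then have \<Lambda>: "ln (2 * R / \<epsilon>) \<ge> 1" "ln (2 * R / \<epsilon>) \<ge> 2 * M / \<delta>" by (auto simp: \<Lambda>_def)
  have R: "R \<ge> S'" "R > 0" using S' \<epsilon> by (auto simp: R_def)
  have "\<not> summable (\<lambda>i. (a (i + k))\<^sup>2)" using a_sq by (subst summable_iff_shift)
  then have "\<not> (\<forall>j. (\<Sum>i<j. (a (i + k))\<^sup>2) \<le> 2 * (R + 1)\<^sup>2 / \<delta>)"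
    using summableI_nonneg_bounded[of "\<lambda>i. (a (i + k))\<^sup>2"] by auto
  then obtain j where j: "(\<Sum>i<j. (a (k + i))\<^sup>2) > 2 * (R + 1)\<^sup>2 / \<delta>"
    by (auto simp: not_le add.commute)
  show thesis
  proof (rule that)
    fix s assume s: "cmod s \<le> S"
    have "miss \<epsilon> j k s \<le> stay \<epsilon> R j k s
        + (max 0 (ln (2 * cmod s / \<epsilon>)) + (\<Sum>i<j. 5 / \<epsilon> ^ 3 * a (k + i) ^ 3)) / ln (2 * R / \<epsilon>)"
      using \<epsilon> R S' \<Lambda> small by (intro miss_le_stay) auto
    moreover have "stay \<epsilon> R j k s \<le> \<delta> / 2"
    proof -
      have "2 * (R + 1)\<^sup>2 / \<delta> * stay \<epsilon> R j k s \<le> (\<Sum>i<j. (a (k + i))\<^sup>2) * stay \<epsilon> R j k s"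
        using j stay_nonneg by (intro mult_right_mono) auto
      also have "\<dots> \<le> (R + 1)\<^sup>2"
        using stay_second_moment[of s R k j \<epsilon>] s R S' zero_le_power2[of "cmod s"] by linarith
      finally have "(R + 1)\<^sup>2 * (2 * stay \<epsilon> R j k s) \<le> (R + 1)\<^sup>2 * \<delta>"
        using \<delta> by (simp add: field_simps)
      then show ?thesis using R by (simp add: mult_le_cancel_left)
    qed
    moreover have "(max 0 (ln (2 * cmod s / \<epsilon>)) + (\<Sum>i<j. 5 / \<epsilon> ^ 3 * a (k + i) ^ 3)) / ln (2 * R / \<epsilon>) \<le> \<delta> / 2"
    proof -
      \<comment> \<open>Monotonicity of \<open>ln\<close> needs a positive argument; for
        \<open>s = 0\<close> the default value \<open>ln 0 = 0\<close> makes the maximum 0.\<close>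
      have "ln (2 * cmod s / \<epsilon>) \<le> ln (2 * S' / \<epsilon>)" if "s \<noteq> 0"
        using that s S' \<epsilon> by (simp add: divide_right_mono)
      moreover have "0 \<le> ln (2 * S' / \<epsilon>)" using S' \<epsilon> by (simp add: field_simps)
      ultimately have "max 0 (ln (2 * cmod s / \<epsilon>)) + (\<Sum>i<j. 5 / \<epsilon> ^ 3 * a (k + i) ^ 3) \<le> M"
        unfolding M_def by (intro add_mono T) (cases "s = 0"; simp)
      also have "M \<le> \<delta> / 2 * ln (2 * R / \<epsilon>)" using \<Lambda> \<delta> by (simp add: field_simps)
      finally show ?thesis using \<Lambda> by (simp add: divide_le_eq)
    qed
    ultimately show "miss \<epsilon> j k s \<le> \<delta>" by linarith
  qed
qed

section \<open>Partial sums on the unit circle\<close>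

definition partial_sum :: "nat \<Rightarrow> real \<Rightarrow> complex" where
  "partial_sum k t = (\<Sum>i<k. of_real (a i) * cis (2 * pi * real (n i) * t))"

text \<open>The floor is not reduced modulo \<open>N k\<close>: multiples of \<open>N k\<close>
  contribute full turns, so only the \<open>k\<close>-th mixed-radix digit of \<open>t\<close>
  matters.\<close>

definition digit_root :: "nat \<Rightarrow> real \<Rightarrow> complex" where
  "digit_root k t = cis (2 * pi * of_int \<lfloor>real (n (Suc k)) * t\<rfloor> / N k)"

definition cell :: "nat \<Rightarrow> nat \<Rightarrow> real set" where
  "cell k c = {real c / n k ..< (real c + 1) / n k}"

lemma n_pos: "0 < n k"
  by (induction k) (use n_0 N_pos in \<open>auto simp: n_Suc\<close>)

lemma cell_iff: "t \<in> cell k c \<longleftrightarrow> \<lfloor>real (n k) * t\<rfloor> = int c"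
  using n_pos[of k] by (simp add: cell_def floor_eq_iff field_simps)

lemma cell_lmeasurable: "cell k c \<in> lmeasurable"
  unfolding cell_def by (rule bounded_set_imp_lmeasurable) auto

lemma measure_cell: "measure lebesgue (cell k c) = 1 / n k"
  by (simp add: cell_def divide_right_mono add_divide_distrib)

text \<open>Divide the floor at level \<open>Suc k\<close> by \<open>N k\<close> with remainder: the
  quotient is the floor at level \<open>k\<close> and the remainder is the next digit.\<close>

lemma cell_split: "cell k c = (\<Union>d<N k. cell (Suc k) (c * N k + d))"
proof (intro set_eqI iffI)
  fix t assume t: "t \<in> cell k c"
  define m where "m = \<lfloor>real (n (Suc k)) * t\<rfloor>"
  have "m div int (N k) = \<lfloor>real (n (Suc k)) * t / N k\<rfloor>"
    unfolding m_def by (simp add: floor_divide_real_eq_div[symmetric])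
  also have "\<dots> = int c" using t N_pos[of k] by (simp add: cell_iff n_Suc)
  finally have "m = int (c * N k + nat (m mod int (N k)))"
    using N_pos[of k] div_mult_mod_eq[of m "int (N k)"] by simp
  moreover have "nat (m mod int (N k)) < N k" using N_pos[of k] by (simp add: nat_less_iff)
  ultimately show "t \<in> (\<Union>d<N k. cell (Suc k) (c * N k + d))"
    unfolding UN_iff by (intro bexI[of _ "nat (m mod int (N k))"]) (simp_all add: cell_iff m_def)
next
  fix t assume "t \<in> (\<Union>d<N k. cell (Suc k) (c * N k + d))"
  then obtain d where d: "d < N k" "\<lfloor>real (n (Suc k)) * t\<rfloor> = int (c * N k + d)"
    by (auto simp: cell_iff)
  have "\<lfloor>real (n k) * t\<rfloor> = \<lfloor>real (n (Suc k)) * t / N k\<rfloor>"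
    using N_pos[of k] by (simp add: n_Suc)
  also have "\<dots> = \<lfloor>real (n (Suc k)) * t\<rfloor> div int (N k)"
    by (simp add: floor_divide_real_eq_div[symmetric])
  also have "\<dots> = int c" using d by simp
  finally show "t \<in> cell k c" by (simp add: cell_iff)
qed

lemma digit_root_cell:
  assumes "t \<in> cell (Suc k) (c * N k + d)"
  shows "digit_root k t = unit_root k d"
proof -
  have "\<lfloor>real (n (Suc k)) * t\<rfloor> = int (c * N k + d)"
    using assms by (simp only: cell_iff)
  then have "digit_root k t = cis (2 * pi * real c + 2 * pi * real d / N k)"
    using N_pos[of k] by (simp add: digit_root_def field_simps)
  then show ?thesis by (simp add: cis_mult[symmetric])
qed

text \<open>Since \<open>n k * t = n (Suc k) * t / N k\<close>, dropping the fractional part of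
  \<open>n (Suc k) * t\<close> moves the angle by at most one \<open>N k\<close>-th of a
  turn.\<close>

lemma digit_root_close: "cmod (cis (2 * pi * real (n k) * t) - digit_root k t) \<le> 2 * pi / N k"
proof -
  let ?x = "real (n (Suc k)) * t"
  have "2 * pi * real (n k) * t - 2 * pi * of_int \<lfloor>?x\<rfloor> / N k = 2 * pi / N k * (?x - of_int \<lfloor>?x\<rfloor>)"
    using N_pos[of k] by (simp add: n_Suc field_simps)
  then have "\<bar>2 * pi * real (n k) * t - 2 * pi * of_int \<lfloor>?x\<rfloor> / N k\<bar> = 2 * pi / N k * \<bar>?x - of_int \<lfloor>?x\<rfloor>\<bar>"
    by (simp add: abs_mult)
  also have "\<dots> \<le> 2 * pi / N k * 1"
  proof (intro mult_left_mono)
    show "\<bar>?x - of_int \<lfloor>?x\<rfloor>\<bar> \<le> 1" by linarith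
  qed simp
  finally show ?thesis
    using norm_cis_diff_le[of "2 * pi * real (n k) * t" "2 * pi * of_int \<lfloor>?x\<rfloor> / N k"]
    unfolding digit_root_def by linarith
qed

section \<open>Measure of the parameters whose digit walk avoids a disc\<close>

definition avoid :: "real \<Rightarrow> nat \<Rightarrow> nat \<Rightarrow> complex \<Rightarrow> nat \<Rightarrow> real set" where
  "avoid \<epsilon> j k s c = {t \<in> cell k c. \<forall>i\<le>j. \<epsilon> \<le> cmod (s + (\<Sum>l<i. of_real (a (k + l)) * digit_root (k + l) t))}"

text \<open>This conditions on the first digit, as the first step is constant on each subcell. The
  hypothesis on \<open>s\<close> settles the index \<open>i = 0\<close>, which the sets on the right
  do not test.\<close>

lemma avoid_Suc:
  assumes "\<epsilon> \<le> cmod s"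
  shows "avoid \<epsilon> (Suc j) k s c = (\<Union>d<N k. avoid \<epsilon> j (Suc k) (s + a k * unit_root k d) (c * N k + d))"
proof -
  let ?A = "\<lambda>d. avoid \<epsilon> j (Suc k) (s + a k * unit_root k d) (c * N k + d)"
  have iff: "t \<in> avoid \<epsilon> (Suc j) k s c \<longleftrightarrow> t \<in> avoid \<epsilon> j (Suc k) (s + a k * unit_root k d) (c * N k + d)"
    if t: "t \<in> cell (Suc k) (c * N k + d)" "d < N k" for t d
  proof -
    have "t \<in> cell k c" using t unfolding cell_split[of k c] by blast
    have step: "s + (\<Sum>l<Suc i. of_real (a (k + l)) * digit_root (k + l) t)
        = s + a k * unit_root k d + (\<Sum>l<i. a (Suc k + l) * digit_root (Suc k + l) t)" for i
      using digit_root_cell[OF t(1)] by (subst sum.lessThan_Suc_shift) simp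
    have split: "(\<forall>i\<le>Suc j. P i) \<longleftrightarrow> P 0 \<and> (\<forall>i\<le>j. P (Suc i))" for P
      unfolding less_Suc_eq_le[symmetric] by (rule All_less_Suc2)
    show ?thesis
      using t \<open>t \<in> cell k c\<close> assms unfolding avoid_def mem_Collect_eq split step by simp
  qed
  show ?thesis
  proof (intro subset_antisym subsetI)
    fix t assume t: "t \<in> avoid \<epsilon> (Suc j) k s c"
    then have "t \<in> cell k c" by (simp add: avoid_def)
    then obtain d where "d < N k" "t \<in> cell (Suc k) (c * N k + d)"
      unfolding cell_split[of k c] by blast
    with t iff show "t \<in> (\<Union>d<N k. ?A d)" by blast
  next
    fix t assume "t \<in> (\<Union>d<N k. ?A d)"
    then obtain d where d: "d < N k" "t \<in> ?A d" by blast
    then have "t \<in> cell (Suc k) (c * N k + d)" by (simp add: avoid_def)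
    with d iff show "t \<in> avoid \<epsilon> (Suc j) k s c" by blast
  qed
qed

text \<open>The \<open>N k\<close> subcells of a cell have equal length, so the recursion through
  \<open>avoid_Suc\<close> averages exactly as \<open>miss\<close> does. This is how the
  independence of the digits enters.\<close>

lemma measure_avoid_le:
  "avoid \<epsilon> j k s c \<in> lmeasurable \<and> measure lebesgue (avoid \<epsilon> j k s c) \<le> miss \<epsilon> j k s / n k"
proof (induction j arbitrary: k s c)
  case 0
  have "avoid \<epsilon> 0 k s c = (if cmod s < \<epsilon> then {} else cell k c)"
    by (auto simp: avoid_def)
  then show ?case by (simp add: cell_lmeasurable measure_cell)
next
  case (Suc j)
  show ?case
  proof (cases "cmod s < \<epsilon>")
    case True
    then have "avoid \<epsilon> (Suc j) k s c = {}" by (force simp: avoid_def)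
    with True show ?thesis by simp
  next
    case False
    let ?A = "\<lambda>d. avoid \<epsilon> j (Suc k) (s + a k * unit_root k d) (c * N k + d)"
    have eq: "avoid \<epsilon> (Suc j) k s c = (\<Union>d<N k. ?A d)"
      using False by (intro avoid_Suc) simp
    have "measure lebesgue (\<Union>d<N k. ?A d) \<le> (\<Sum>d<N k. measure lebesgue (?A d))"
      using Suc.IH by (intro measure_UNION_le) (auto simp: fmeasurableD)
    also have "\<dots> \<le> (\<Sum>d<N k. miss \<epsilon> j (Suc k) (s + a k * unit_root k d) / n (Suc k))"
      using Suc.IH by (intro sum_mono) blast
    also have "\<dots> = miss \<epsilon> (Suc j) k s / n k"
      using False by (simp add: n_Suc sum_divide_distrib)
    finally show ?thesis
      using Suc.IH unfolding eq by (auto intro!: fmeasurable.finite_UN)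
  qed
qed

section \<open>Oscillation of the partial sums and their distance from the walk\<close>

lemma weighted_sum_small: "(\<lambda>k. (\<Sum>i<k. a i * n i) / n k) \<longlonglongrightarrow> 0"
proof -
  \<comment> \<open>The recursion \<open>e (Suc k) \<le> (e k + a k) / 2\<close> is a contraction
    with vanishing perturbation. The limit is used twice: for the oscillation of a partial sum on a
    cell and for the passage from the unit circle to a nearby smaller one.\<close>
  define e where "e k = (\<Sum>i<k. a i * n i) / n k" for k
  have e_Suc: "e (Suc k) = (e k + a k) / N k" for k
    using n_pos[of k] by (simp add: e_def n_Suc field_simps)
  have e_nonneg: "0 \<le> e k" for k
    unfolding e_def using a_nonneg by (intro divide_nonneg_nonneg sum_nonneg) auto
  have e_Suc_le: "e (Suc k) \<le> (e k + a k) / 2" for k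
    unfolding e_Suc using N_ge[of k] e_nonneg[of k] a_nonneg[of k] by (intro divide_left_mono) auto
  have e_le_1: "e k \<le> 1" for k
  proof (induction k)
    case 0
    show ?case by (simp add: e_def)
  next
    case (Suc k)
    then show ?case using e_Suc_le[of k] a_le_1[of k] by (auto simp: field_simps)
  qed
  have "e \<longlonglongrightarrow> 0"
  proof (rule LIMSEQ_I)
    fix r :: real assume r: "r > 0"
    obtain k0 where k0: "\<And>k. k \<ge> k0 \<Longrightarrow> a k < r / 2"
      using order_tendstoD(2)[OF a_lim, of "r / 2"] r by (auto simp: eventually_sequentially)
    \<comment> \<open>Once \<open>a\<close> is below \<open>r / 2\<close>, the excess of
      \<open>e\<close> over \<open>r / 2\<close> at least halves at each step, and it starts out at
      most 1 by \<open>e_le_1\<close>.\<close>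
    have step: "e (k0 + k) \<le> r / 2 + (1 / 2) ^ k" for k
    proof (induction k)
      case 0
      show ?case using e_le_1[of k0] r by simp
    next
      case (Suc k)
      then show ?case using e_Suc_le[of "k0 + k"] k0[of "k0 + k"] by simp
    qed
    have "(\<lambda>k. (1 / 2) ^ k) \<longlonglongrightarrow> (0::real)" by (rule LIMSEQ_power_zero) simp
    from order_tendstoD(2)[OF this, of "r / 2"]
    obtain k1 where k1: "\<And>k. k \<ge> k1 \<Longrightarrow> (1 / 2) ^ k < r / 2"
      using r by (auto simp: eventually_sequentially)
    show "\<exists>no. \<forall>k\<ge>no. norm (e k - 0) < r"
    proof (intro exI allI impI)
      fix k assume k: "k0 + k1 \<le> k"
      have "e k \<le> r / 2 + (1 / 2) ^ (k - k0)" using step[of "k - k0"] k by simp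
      also have "\<dots> < r" using k1[of "k - k0"] k by linarith
      finally show "norm (e k - 0) < r" using e_nonneg[of k] by simp
    qed
  qed
  then show ?thesis by (simp add: e_def[abs_def])
qed

lemma partial_sum_lipschitz:
  "cmod (partial_sum k t - partial_sum k u) \<le> 2 * pi * (\<Sum>i<k. a i * n i) * \<bar>t - u\<bar>"
proof -
  have "cmod (partial_sum k t - partial_sum k u)
     \<le> (\<Sum>i<k. cmod (of_real (a i) * cis (2 * pi * real (n i) * t) - of_real (a i) * cis (2 * pi * real (n i) * u)))"
    unfolding partial_sum_def sum_subtractf[symmetric] by (rule norm_sum)
  also have "\<dots> \<le> (\<Sum>i<k. a i * (2 * pi * n i * \<bar>t - u\<bar>))"
  proof (rule sum_mono)
    fix i
    have "cmod (of_real (a i) * cis (2 * pi * real (n i) * t) - of_real (a i) * cis (2 * pi * real (n i) * u))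
        = a i * cmod (cis (2 * pi * real (n i) * t) - cis (2 * pi * real (n i) * u))"
      using a_nonneg[of i] by (simp add: right_diff_distrib[symmetric] norm_mult)
    also have "\<dots> \<le> a i * \<bar>2 * pi * real (n i) * t - 2 * pi * real (n i) * u\<bar>"
      using a_nonneg[of i] norm_cis_diff_le by (intro mult_left_mono) auto
    also have "\<bar>2 * pi * real (n i) * t - 2 * pi * real (n i) * u\<bar> = 2 * pi * n i * \<bar>t - u\<bar>"
      by (simp add: right_diff_distrib[symmetric] abs_mult)
    finally show "cmod (of_real (a i) * cis (2 * pi * real (n i) * t) - of_real (a i) * cis (2 * pi * real (n i) * u))
        \<le> a i * (2 * pi * n i * \<bar>t - u\<bar>)" .
  qed
  also have "\<dots> = 2 * pi * (\<Sum>i<k. a i * n i) * \<bar>t - u\<bar>"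
    by (simp add: sum_distrib_left sum_distrib_right mult_ac)
  finally show ?thesis .
qed

text \<open>Replacing each exponential by its digit root costs \<open>2 * pi * a l / N l\<close>,
  and the total is a tail of a convergent series, uniformly in \<open>i\<close> and
  \<open>t\<close>.\<close>

lemma partial_sum_shift_close:
  "cmod (partial_sum (k + i) t - partial_sum k t - (\<Sum>l<i. of_real (a (k + l)) * digit_root (k + l) t))
    \<le> 2 * pi * (\<Sum>l. a (k + l) / N (k + l))"
proof -
  have "partial_sum (k + i) t - partial_sum k t = (\<Sum>l<i. of_real (a (k + l)) * cis (2 * pi * real (n (k + l)) * t))"
    by (induction i) (simp_all add: partial_sum_def algebra_simps)
  then have "cmod (partial_sum (k + i) t - partial_sum k t - (\<Sum>l<i. of_real (a (k + l)) * digit_root (k + l) t))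
      \<le> (\<Sum>l<i. cmod (of_real (a (k + l)) * cis (2 * pi * real (n (k + l)) * t) - of_real (a (k + l)) * digit_root (k + l) t))"
    by (simp only: sum_subtractf[symmetric] norm_sum)
  also have "\<dots> \<le> (\<Sum>l<i. 2 * pi * (a (k + l) / N (k + l)))"
  proof (rule sum_mono)
    fix l
    have "cmod (of_real (a (k + l)) * cis (2 * pi * real (n (k + l)) * t) - of_real (a (k + l)) * digit_root (k + l) t)
      = a (k + l) * cmod (cis (2 * pi * real (n (k + l)) * t) - digit_root (k + l) t)"
      using a_nonneg[of "k + l"] by (simp add: right_diff_distrib[symmetric] norm_mult)
    also have "\<dots> \<le> a (k + l) * (2 * pi / N (k + l))"
      using a_nonneg digit_root_close by (intro mult_left_mono) auto
    finally show "cmod (of_real (a (k + l)) * cis (2 * pi * real (n (k + l)) * t) - of_real (a (k + l)) * digit_root (k + l) t)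
      \<le> 2 * pi * (a (k + l) / N (k + l))" by (simp add: mult_ac)
  qed
  also have "\<dots> \<le> 2 * pi * (\<Sum>l. a (k + l) / N (k + l))"
  proof -
    have "summable (\<lambda>l. a (k + l) / N (k + l))"
      using a_over_N summable_iff_shift[of "\<lambda>l. a l / N l" k] by (simp add: add.commute)
    then show ?thesis
      unfolding sum_distrib_left[symmetric] using a_nonneg
      by (intro mult_left_mono sum_le_suminf) auto
  qed
  finally show ?thesis .
qed

lemma norm_partial_sum_le: "cmod (partial_sum k t) \<le> k"
proof -
  have "cmod (partial_sum k t) \<le> (\<Sum>i<k. cmod (of_real (a i) * cis (2 * pi * real (n i) * t)))"
    unfolding partial_sum_def by (rule norm_sum)
  also have "\<dots> \<le> (\<Sum>i<k. 1)"
    using a_nonneg a_le_1 by (intro sum_mono) (simp add: norm_mult)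
  finally show ?thesis by simp
qed

text \<open>On a cell of a late level \<open>k\<close> the partial sum is nearly constant, and the
  later increments follow the digit walk. Each approximation costs \<open>\<epsilon> / 4\<close>, so
  partial sums at distance at least \<epsilon> from \<open>w\<close> force the walk to avoid the
  disc of radius \<open>\<epsilon> / 2\<close>, an event of measure at most \<delta> once
  \<open>j\<close> is large.\<close>

lemma negligible_avoiding:
  assumes \<epsilon>: "0 < \<epsilon>"
  shows "negligible {t \<in> {0..<1}. \<forall>k\<ge>k0. \<epsilon> \<le> cmod (partial_sum k t - w)}"
    (is "negligible ?B")
  unfolding negligible_outer_le
proof (intro allI impI)
  fix \<delta> :: real assume \<delta>: "\<delta> > 0"
  have tail: "(\<lambda>k. \<Sum>l. a (k + l) / N (k + l)) \<longlonglongrightarrow> 0"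
    using suminf_exist_split2[OF a_over_N] by (simp add: add.commute)
  \<comment> \<open>The factor \<open>8 * pi\<close> turns the \<open>2 * pi\<close> in both
    comparison bounds into \<open>\<epsilon> / 4\<close>. The bound \<open>\<epsilon> / 4\<close> on
    \<open>a i\<close> is the step size that \<open>miss_small\<close> demands for radius
    \<open>\<epsilon> / 2\<close>.\<close>
  have "\<forall>\<^sub>F k in sequentially. (\<Sum>i<k. a i * n i) / n k < \<epsilon> / (8 * pi)
      \<and> (\<Sum>l. a (k + l) / N (k + l)) < \<epsilon> / (8 * pi) \<and> k0 \<le> k"
    using \<epsilon> by (intro eventually_conj order_tendstoD(2)[OF weighted_sum_small]
        order_tendstoD(2)[OF tail] eventually_ge_at_top) auto
  moreover have "\<forall>\<^sub>F k in sequentially. \<forall>i\<ge>k. a i < \<epsilon> / 4"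
    using \<epsilon> by (intro eventually_all_ge_at_top order_tendstoD(2)[OF a_lim]) auto
  ultimately have "\<forall>\<^sub>F k in sequentially. ((\<Sum>i<k. a i * n i) / n k < \<epsilon> / (8 * pi)
      \<and> (\<Sum>l. a (k + l) / N (k + l)) < \<epsilon> / (8 * pi) \<and> k0 \<le> k) \<and> (\<forall>i\<ge>k. a i < \<epsilon> / 4)"
    by (rule eventually_conj)
  then obtain k where k: "(\<Sum>i<k. a i * n i) / n k < \<epsilon> / (8 * pi)"
      "(\<Sum>l. a (k + l) / N (k + l)) < \<epsilon> / (8 * pi)" "k0 \<le> k" "\<And>i. k \<le> i \<Longrightarrow> a i < \<epsilon> / 4"
    by (auto dest: eventually_happens)
  \<comment> \<open>The trivial bound \<open>k\<close> on the partial sum confines all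
    \<open>n k\<close> starting points to one disc, so a single \<open>j\<close> works for every
    cell.\<close>
  obtain j where j: "\<And>s. cmod s \<le> k + cmod w \<Longrightarrow> miss (\<epsilon> / 2) j k s \<le> \<delta>"
    by (rule miss_small[of "\<epsilon> / 2" k \<delta> "k + cmod w"]) (use \<epsilon> \<delta> k(4) in \<open>auto simp: less_imp_le\<close>)
  define s where "s c = partial_sum k (real c / n k) - w" for c :: nat
  define T where "T = (\<Union>c<n k. avoid (\<epsilon> / 2) j k (s c) c)"
  have "?B \<subseteq> T"
  proof
    fix t assume t: "t \<in> ?B"
    define c where "c = nat \<lfloor>real (n k) * t\<rfloor>"
    have c: "\<lfloor>real (n k) * t\<rfloor> = int c" using t by (simp add: c_def)
    then have tc: "t \<in> cell k c" by (simp add: cell_iff)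
    have "real (n k) * t < n k" using t n_pos[of k] by simp
    then have "c < n k" using c by linarith
    have "\<bar>t - real c / n k\<bar> \<le> 1 / n k"
      using tc by (auto simp: cell_def add_divide_distrib abs_le_iff)
    then have "2 * pi * (\<Sum>i<k. a i * n i) * \<bar>t - real c / n k\<bar> \<le> 2 * pi * (\<Sum>i<k. a i * n i) * (1 / n k)"
      using a_nonneg by (intro mult_left_mono mult_nonneg_nonneg sum_nonneg) auto
    also have "\<dots> \<le> \<epsilon> / 4"
      using k(1) by (simp add: field_simps)
    finally have osc: "cmod (partial_sum k t - partial_sum k (real c / n k)) \<le> \<epsilon> / 4"
      using partial_sum_lipschitz[of k t "real c / n k"] by linarith
    have "\<epsilon> / 2 \<le> cmod (s c + (\<Sum>l<i. of_real (a (k + l)) * digit_root (k + l) t))" for i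
    proof -
      define D where "D = (\<Sum>l<i. of_real (a (k + l)) * digit_root (k + l) t)"
      have "cmod (partial_sum (k + i) t - partial_sum k t - D) \<le> \<epsilon> / 4"
        using partial_sum_shift_close[of k i t] k(2) by (simp add: D_def field_simps)
      moreover have "\<epsilon> \<le> cmod (partial_sum (k + i) t - w)" using t k(3) by simp
      moreover have "partial_sum (k + i) t - w = (s c + D)
          + (partial_sum k t - partial_sum k (real c / n k)) + (partial_sum (k + i) t - partial_sum k t - D)"
        by (simp add: s_def)
      ultimately show ?thesis
        using osc norm_triangle_ineq[of "s c + D + (partial_sum k t - partial_sum k (real c / n k))" 
            "partial_sum (k + i) t - partial_sum k t - D"]
          norm_triangle_ineq[of "s c + D" "partial_sum k t - partial_sum k (real c / n k)"]
        unfolding D_def by simp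
    qed
    then have "t \<in> avoid (\<epsilon> / 2) j k (s c) c" using tc by (simp add: avoid_def)
    then show "t \<in> T" using \<open>c < n k\<close> by (auto simp: T_def)
  qed
  moreover have "T \<in> lmeasurable"
    unfolding T_def using measure_avoid_le by (intro fmeasurable.finite_UN) auto
  moreover have "measure lebesgue T \<le> \<delta>"
  proof -
    have "measure lebesgue T \<le> (\<Sum>c<n k. measure lebesgue (avoid (\<epsilon> / 2) j k (s c) c))"
      unfolding T_def using measure_avoid_le by (intro measure_UNION_le) (auto simp: fmeasurableD)
    also have "\<dots> \<le> (\<Sum>c<n k. \<delta> / n k)"
    proof (rule sum_mono)
      fix c
      have "cmod (s c) \<le> k + cmod w"
        using norm_triangle_ineq4[of "partial_sum k (real c / n k)" w] norm_partial_sum_le[of k "real c / n k"]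
        by (simp add: s_def)
      then have "miss (\<epsilon> / 2) j k (s c) / n k \<le> \<delta> / n k"
        by (intro divide_right_mono j) auto
      then show "measure lebesgue (avoid (\<epsilon> / 2) j k (s c) c) \<le> \<delta> / n k"
        using measure_avoid_le order_trans by blast
    qed
    also have "\<dots> = \<delta>" using n_pos[of k] by simp
    finally show ?thesis .
  qed
  ultimately show "\<exists>T. ?B \<subseteq> T \<and> T \<in> lmeasurable \<and> measure lebesgue T \<le> \<delta>" by blast
qed

section \<open>The lacunary series\<close>

definition lacunary_series :: "complex \<Rightarrow> complex" where
  "lacunary_series z = (\<Sum>k. of_real (a k) * z ^ n k)"

text \<open>At this radius powers with exponent far below \<open>n k\<close> are close to their
  boundary values, and those with exponent \<open>n (Suc k)\<close> or higher are damped
  geometrically. The borderline exponent \<open>n k\<close> is harmless because \<open>a k\<close>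
  tends to 0.\<close>

definition radius :: "nat \<Rightarrow> real" where
  "radius k = 1 - 1 / n k"

section \<open>Gap estimates and the Bloch property\<close>

lemma n_double: "2 * n k \<le> n (Suc k)"
  unfolding n_Suc using N_ge[of k] by (intro mult_right_mono) auto

lemma less_n: "k < n k"
proof (induction k)
  case 0
  show ?case by (rule n_0)
next
  case (Suc k)
  then show ?case using n_double[of k] by linarith
qed

lemma n_growth: "n k * 2 ^ i \<le> n (k + i)"
proof (induction i)
  case (Suc i)
  then show ?case using n_double[of "k + i"] by simp
qed simp

text \<open>Since \<open>n k \<le> 2 (n k - n (k - 1))\<close>, each term is controlled by a block of the geometric series.\<close>

lemma sum_n_power_le_geometric:
  fixes r :: real
  assumes "0 \<le> r" "r \<le> 1"
  shows "(\<Sum>i\<le>k. n i * r ^ (n i - 1)) \<le> 2 * (\<Sum>m<n k. r ^ m)"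
proof -
  have block: "real (q - p) * r ^ (q - 1) \<le> (\<Sum>m=p..<q. r ^ m)" for p q
  proof -
    have "(\<Sum>m=p..<q. r ^ (q - 1)) \<le> (\<Sum>m=p..<q. r ^ m)"
      using assms by (intro sum_mono power_decreasing) auto
    then show ?thesis by simp
  qed
  show ?thesis
  proof (induction k)
    case 0
    have "n 0 * r ^ (n 0 - 1) \<le> (\<Sum>m<n 0. r ^ m)"
      using block[of "n 0" 0] by (simp add: atLeast0LessThan)
    moreover have "0 \<le> (\<Sum>m<n 0. r ^ m)" using assms by (intro sum_nonneg) auto
    ultimately show ?case by simp
  next
    case (Suc k)
    have "real (n (Suc k)) \<le> 2 * real (n (Suc k) - n k)" using n_double[of k] by linarith
    then have "n (Suc k) * r ^ (n (Suc k) - 1) \<le> 2 * real (n (Suc k) - n k) * r ^ (n (Suc k) - 1)"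
      using assms by (intro mult_right_mono) auto
    also have "\<dots> \<le> 2 * (\<Sum>m=n k..<n (Suc k). r ^ m)"
      using block[of "n (Suc k)" "n k"] by simp
    finally have "(\<Sum>i\<le>Suc k. n i * r ^ (n i - 1))
        \<le> 2 * (\<Sum>m<n k. r ^ m) + 2 * (\<Sum>m=n k..<n (Suc k). r ^ m)"
      using Suc by simp
    also have "\<dots> = 2 * (\<Sum>m<n (Suc k). r ^ m)"
    proof -
      have "n k \<le> n (Suc k)" using n_double[of k] by linarith
      then have "(\<Sum>m<n k. r ^ m) + (\<Sum>m=n k..<n (Suc k). r ^ m) = (\<Sum>m<n (Suc k). r ^ m)"
        using sum.atLeastLessThan_concat[of 0 "n k" "n (Suc k)" "\<lambda>m. r ^ m"] by (simp add: atLeast0LessThan)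
      then show ?thesis by simp
    qed
    finally show ?case .
  qed
qed

lemma geometric_le:
  fixes r :: real
  assumes "0 \<le> r" "r < 1"
  shows "(\<Sum>m<q. r ^ m) \<le> 1 / (1 - r)"
  using assms by (simp add: sum_gp_strict divide_right_mono)

text \<open>This series majorises the derivative on the circle of radius \<open>r\<close>. As the
  coefficients are at most 1, the comparison with the geometric series gives the order
  \<open>1 / (1 - r)\<close> that the Bloch condition asks for.\<close>

lemma
  fixes r :: real
  assumes r: "0 \<le> r" "r < 1"
  shows summable_deriv: "summable (\<lambda>i. a i * (n i * r ^ (n i - 1)))"
    and suminf_deriv_le: "(\<Sum>i. a i * (n i * r ^ (n i - 1))) \<le> 2 / (1 - r)"
proof -
  have bound: "(\<Sum>i<k. a i * (n i * r ^ (n i - 1))) \<le> 2 / (1 - r)" for k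
  proof -
    have "(\<Sum>i<k. a i * (n i * r ^ (n i - 1))) \<le> (\<Sum>i<k. n i * r ^ (n i - 1))"
      using r a_le_1 a_nonneg by (intro sum_mono mult_left_le_one_le) auto
    also have "\<dots> \<le> (\<Sum>i\<le>k. n i * r ^ (n i - 1))"
      using r by (intro sum_mono2) auto
    also have "\<dots> \<le> 2 * (\<Sum>m<n k. r ^ m)"
      using r by (intro sum_n_power_le_geometric) auto
    also have "\<dots> \<le> 2 / (1 - r)"
      using geometric_le[OF r, of "n k"] by simp
    finally show ?thesis .
  qed
  show summ: "summable (\<lambda>i. a i * (n i * r ^ (n i - 1)))"
    using a_nonneg r by (intro summableI_nonneg_bounded[OF _ bound]) auto
  show "(\<Sum>i. a i * (n i * r ^ (n i - 1))) \<le> 2 / (1 - r)"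
    by (rule suminf_le_const[OF summ bound])
qed

lemma summable_lacunary_series:
  assumes "cmod z < 1"
  shows "summable (\<lambda>k. cmod (of_real (a k) * z ^ n k))"
proof (rule summable_comparison_test'[where N = 0])
  show "summable (\<lambda>k. cmod z ^ k)" using assms by (intro summable_geometric) simp
  fix k
  have "a k * cmod z ^ n k \<le> 1 * cmod z ^ k"
    using assms a_nonneg a_le_1 less_n[of k] by (intro mult_mono power_decreasing) auto
  then show "norm (cmod (of_real (a k) * z ^ n k)) \<le> cmod z ^ k"
    using a_nonneg[of k] by (simp add: norm_mult norm_power)
qed

lemma lacunary_series_has_deriv:
  assumes "cmod z < 1"
  shows "(lacunary_series has_field_derivative (\<Sum>k. of_real (a k) * (of_nat (n k) * z ^ (n k - 1)))) (at z)"
  unfolding lacunary_series_def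
proof (rule has_field_derivative_series'(2)[where S = "ball 0 ((1 + cmod z) / 2)" and ?x0.0 = 0])
  \<comment> \<open>This lies strictly between \<open>cmod z\<close> and 1, so the disc contains
    \<open>z\<close> and the majorant at its radius still converges.\<close>
  let ?\<rho> = "(1 + cmod z) / 2"
  have \<rho>: "0 \<le> ?\<rho>" "?\<rho> < 1" using assms by auto
  show "((\<lambda>x. of_real (a k) * x ^ n k) has_field_derivative of_real (a k) * (of_nat (n k) * x ^ (n k - 1)))
      (at x within ball 0 ?\<rho>)" for k x
    by (auto intro!: derivative_eq_intros)
  show "uniformly_convergent_on (ball 0 ?\<rho>)
      (\<lambda>k x. \<Sum>i<k. of_real (a i) * (of_nat (n i) * x ^ (n i - 1)) :: complex)"
  proof (rule Weierstrass_m_test'[OF _ summable_deriv[OF \<rho>]])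
    fix k and x :: complex assume "x \<in> ball 0 ?\<rho>"
    then show "norm (of_real (a k) * (of_nat (n k) * x ^ (n k - 1))) \<le> a k * (n k * ?\<rho> ^ (n k - 1))"
      using a_nonneg[of k] by (auto simp: norm_mult norm_power intro!: mult_left_mono power_mono)
  qed
  show "summable (\<lambda>k. of_real (a k) * (0::complex) ^ n k)"
    using n_pos by (simp add: power_0_left less_imp_neq[THEN not_sym])
  show "0 \<in> ball 0 ?\<rho>" by (simp add: add_pos_nonneg)
qed (use assms in auto)

lemma lacunary_series_Bloch: "lacunary_series \<in> Bloch"
proof -
  have "lacunary_series holomorphic_on ball 0 1"
    unfolding holomorphic_on_open[OF open_ball] using lacunary_series_has_deriv by (metis mem_ball_0)
  moreover have "(1 - (cmod z)\<^sup>2) * cmod (deriv lacunary_series z) \<le> 4" if z: "cmod z < 1" for z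
  proof -
    let ?c = "\<lambda>k. a k * (n k * cmod z ^ (n k - 1))"
    have nc: "norm (of_real (a k) * (of_nat (n k) * z ^ (n k - 1))) = ?c k" for k
      using a_nonneg[of k] by (simp add: norm_mult norm_power)
    have "deriv lacunary_series z = (\<Sum>k. of_real (a k) * (of_nat (n k) * z ^ (n k - 1)))"
      by (rule DERIV_imp_deriv[OF lacunary_series_has_deriv[OF z]])
    also have "cmod \<dots> \<le> (\<Sum>k. ?c k)"
      using summable_deriv[of "cmod z"] z unfolding nc[symmetric] by (intro summable_norm) auto
    also have "\<dots> \<le> 2 / (1 - cmod z)"
      using z by (intro suminf_deriv_le) auto
    finally have "(1 - (cmod z)\<^sup>2) * cmod (deriv lacunary_series z) \<le> (1 - (cmod z)\<^sup>2) * (2 / (1 - cmod z))"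
      using z by (intro mult_left_mono) (auto simp: power_le_one)
    also have "\<dots> = 2 * (1 + cmod z)"
      using z by (simp add: field_simps power2_eq_square)
    finally show ?thesis using z by simp
  qed
  ultimately show ?thesis
    by (auto simp: Bloch_def intro!: bdd_aboveI[where M = 4])
qed

section \<open>Comparison of the series with its partial sums on suitable circles\<close>

lemma radius_bounds: "0 \<le> radius k" "radius k < 1" "1 - radius k \<le> 1 / (real k + 1)"
proof -
  show "0 \<le> radius k" "radius k < 1" using n_pos[of k] by (auto simp: radius_def)
  have "real k + 1 \<le> n k" using less_n[of k] by linarith
  then show "1 - radius k \<le> 1 / (real k + 1)" by (simp add: radius_def frac_le)
qed

lemma radius_power_ge: "1 - radius k ^ n i \<le> n i / n k"
  using Bernoulli_inequality[of "- 1 / n k" "n i"] n_pos[of k] by (simp add: radius_def)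

text \<open>For \<open>m = n (k + Suc i)\<close> the product \<open>m * r ^ m\<close> is at most the
  geometric sum with \<open>m\<close> terms, hence at most \<open>1 / (1 - r) = n k\<close>, while
  \<open>m\<close> is at least \<open>n k * 2 ^ Suc i\<close>.\<close>

lemma radius_power_le: "radius k ^ n (k + Suc i) \<le> (1 / 2) ^ Suc i"
proof -
  let ?r = "radius k" and ?m = "n (k + Suc i)"
  have "?m * ?r ^ ?m = (\<Sum>j<?m. ?r ^ ?m)" by simp
  also have "\<dots> \<le> (\<Sum>j<?m. ?r ^ j)"
    using radius_bounds[of k] by (intro sum_mono power_decreasing) auto
  also have "\<dots> \<le> 1 / (1 - ?r)" using radius_bounds[of k] by (intro geometric_le) auto
  also have "\<dots> = n k" by (simp add: radius_def)
  finally have "real (n k * 2 ^ Suc i) * ?r ^ ?m \<le> n k"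
    using mult_right_mono[of "real (n k * 2 ^ Suc i)" "real ?m" "?r ^ ?m"] n_growth[of k "Suc i"]
      radius_bounds[of k] of_nat_mono[of "n k * 2 ^ Suc i" ?m] by (simp del: power_Suc of_nat_mult of_nat_power)
  then have "2 ^ Suc i * ?r ^ ?m \<le> 1" using n_pos[of k] by simp
  then show ?thesis by (simp add: power_divide field_simps)
qed

text \<open>The error has three parts. Powers below \<open>n k\<close> are compared with their
  boundary values by Bernoulli's inequality and \<open>weighted_sum_small\<close>, the term with
  exponent \<open>n k\<close> costs at most \<open>a k\<close>, and the tail is at most
  \<open>\<eta> / 3\<close> times a geometric series of sum 1.\<close>

lemma lacunary_series_radial_close:
  assumes "0 < \<eta>"
  shows "\<forall>\<^sub>F k in sequentially. \<forall>t. cmod (lacunary_series (of_real (radius k) * cis (2 * pi * t)) - partial_sum (Suc k) t) < \<eta>"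
proof -
  have "\<forall>\<^sub>F k in sequentially. (\<Sum>i<k. a i * n i) / n k < \<eta> / 3"
    using assms by (intro order_tendstoD(2)[OF weighted_sum_small]) auto
  moreover have "\<forall>\<^sub>F k in sequentially. \<forall>i\<ge>k. a i < \<eta> / 3"
    using assms by (intro eventually_all_ge_at_top order_tendstoD(2)[OF a_lim]) auto
  ultimately show ?thesis
  proof eventually_elim
    case (elim k)
    show ?case
    proof
      fix t :: real
      define \<zeta> where "\<zeta> = cis (2 * pi * t)"
      define r where "r = radius k"
      define u where "u i = of_real (a i) * (of_real r * \<zeta>) ^ n i" for i
      define v where "v i = of_real (a i) * \<zeta> ^ n i" for i
      have r: "0 \<le> r" "r < 1" using radius_bounds[of k] by (auto simp: r_def)
      have nu: "cmod (u i) = a i * r ^ n i" for i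
        using a_nonneg[of i] r by (simp add: u_def \<zeta>_def norm_mult norm_power)
      have summ: "summable (\<lambda>i. cmod (u i))"
        unfolding u_def using r by (intro summable_lacunary_series) (simp add: \<zeta>_def norm_mult)
      have "lacunary_series (of_real r * \<zeta>) = (\<Sum>i. u (i + Suc k)) + (\<Sum>i<Suc k. u i)"
        unfolding lacunary_series_def u_def[symmetric]
        by (rule suminf_split_initial_segment) (rule summable_norm_cancel[OF summ])
      moreover have "partial_sum (Suc k) t = (\<Sum>i<Suc k. v i)"
        by (simp add: partial_sum_def v_def \<zeta>_def Complex.DeMoivre mult_ac)
      ultimately have eq: "lacunary_series (of_real r * \<zeta>) - partial_sum (Suc k) t
          = (\<Sum>i. u (i + Suc k)) + (\<Sum>i<Suc k. u i - v i)"
        by (simp add: sum_subtractf)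
      have "cmod (\<Sum>i<Suc k. u i - v i) \<le> (\<Sum>i<Suc k. a i * n i / n k)"
      proof (rule sum_norm_le)
        fix i
        have "u i - v i = of_real (a i * (r ^ n i - 1)) * \<zeta> ^ n i"
          by (simp add: u_def v_def power_mult_distrib algebra_simps)
        then have "cmod (u i - v i) = a i * (1 - r ^ n i)"
          using a_nonneg[of i] r power_le_one[of r "n i"]
          by (simp add: norm_mult norm_power \<zeta>_def abs_mult del: of_real_mult of_real_diff of_real_power)
        also have "\<dots> \<le> a i * (n i / n k)"
          unfolding r_def using a_nonneg by (intro mult_left_mono radius_power_ge) auto
        finally show "cmod (u i - v i) \<le> a i * n i / n k" by simp
      qed
      also have "\<dots> = (\<Sum>i<k. a i * n i) / n k + a k"
        using n_pos[of k] by (simp add: sum_divide_distrib)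
      also have "\<dots> < \<eta> / 3 + \<eta> / 3" using elim by (intro add_strict_mono) auto
      finally have head: "cmod (\<Sum>i<Suc k. u i - v i) < \<eta> / 3 + \<eta> / 3" .
      have "cmod (\<Sum>i. u (i + Suc k)) \<le> (\<Sum>i. \<eta> / 3 * (1 / 2) ^ Suc i)"
      proof (rule norm_suminf_le)
        show "summable (\<lambda>i. \<eta> / 3 * (1 / 2) ^ Suc i)"
          using power_half_series by (intro summable_mult) (rule sums_summable)
        fix i
        have "a (k + Suc i) * r ^ n (k + Suc i) \<le> \<eta> / 3 * (1 / 2) ^ Suc i"
          unfolding r_def using elim(2)[rule_format, of "k + Suc i"] assms radius_bounds[of k]
          by (intro mult_mono radius_power_le) auto
        moreover have "k + Suc i = i + Suc k" by simp
        ultimately show "cmod (u (i + Suc k)) \<le> \<eta> / 3 * (1 / 2) ^ Suc i"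
          by (simp only: nu)
      qed
      also have "\<dots> = \<eta> / 3"
        using sums_unique[OF sums_mult[OF power_half_series, of "\<eta> / 3"]] by (simp only: mult_1_right)
      finally have "cmod (\<Sum>i. u (i + Suc k)) \<le> \<eta> / 3" .
      then have "cmod (lacunary_series (of_real r * \<zeta>) - partial_sum (Suc k) t) < \<eta>"
        unfolding eq using head norm_triangle_ineq[of "\<Sum>i. u (i + Suc k)" "\<Sum>i<Suc k. u i - v i"] by linarith
      then show "cmod (lacunary_series (of_real (radius k) * cis (2 * pi * t)) - partial_sum (Suc k) t) < \<eta>"
        by (simp only: r_def \<zeta>_def)
    qed
  qed
qed

section \<open>Maximality of the radial cluster sets almost everywhere\<close>

lemma partial_sums_dense:
  obtains Z where "negligible Z"
    "\<And>t w \<epsilon> k0. t \<in> {0..<1} - Z \<Longrightarrow> 0 < \<epsilon> \<Longrightarrow> \<exists>k\<ge>k0. cmod (partial_sum k t - w) < \<epsilon>"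
proof -
  \<comment> \<open>Centres in a countable dense set, radii \<open>1 / (m + 1)\<close> and all
    starting indices give countably many negligible sets, whose union handles every disc.\<close>
  obtain D :: "complex set" where D: "countable D" "\<And>X. open X \<Longrightarrow> X \<noteq> {} \<Longrightarrow> \<exists>d\<in>D. d \<in> X"
    by (rule countable_dense_setE) blast
  define B where "B w m k0 = {t \<in> {0..<1}. \<forall>k\<ge>k0. 1 / (real m + 1) \<le> cmod (partial_sum k t - w)}"
    for w :: complex and m k0 :: nat
  define Z where "Z = (\<Union>(w, m, k0)\<in>D \<times> UNIV. B w m k0)"
  show thesis
  proof (rule that[of Z])
    have "negligible (B w m k0)" for w m k0
      unfolding B_def by (rule negligible_avoiding) simp
    then show "negligible Z"
      unfolding Z_def using D(1) by (intro negligible_countable_Union countable_image countable_SIGMA) auto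
    fix t w and \<epsilon> :: real and k0 assume t: "t \<in> {0..<1} - Z" and \<epsilon>: "0 < \<epsilon>"
    obtain m :: nat where m: "1 / (real m + 1) < \<epsilon> / 2"
      using reals_Archimedean[of "\<epsilon> / 2"] \<epsilon> by (auto simp: inverse_eq_divide add.commute)
    obtain d where d: "d \<in> D" "d \<in> ball w (\<epsilon> / 2)"
      using D(2)[of "ball w (\<epsilon> / 2)"] \<epsilon> by auto
    have "t \<notin> B d m k0" using t d(1) by (auto simp: Z_def)
    then obtain k where k: "k \<ge> k0" "cmod (partial_sum k t - d) < 1 / (real m + 1)"
      using t by (auto simp: B_def not_le)
    have "cmod (partial_sum k t - w) \<le> cmod (partial_sum k t - d) + cmod (d - w)"
      using norm_triangle_ineq[of "partial_sum k t - d" "d - w"] by simp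
    also have "\<dots> < \<epsilon>"
      using k(2) m d(2) by (simp add: dist_norm norm_minus_commute)
    finally show "\<exists>k\<ge>k0. cmod (partial_sum k t - w) < \<epsilon>" using k(1) by blast
  qed
qed

lemma maximal_cluster_lacunary_series:
  assumes dense: "\<And>w \<epsilon> k0. 0 < \<epsilon> \<Longrightarrow> \<exists>k\<ge>k0. cmod (partial_sum k t - w) < \<epsilon>"
  shows "maximal_cluster (radial_cluster_set lacunary_series (cis (2 * pi * t)))"
proof -
  define F where "F k = lacunary_series (of_real (radius k) * cis (2 * pi * t))" for k
  have F_dense: "\<exists>k\<ge>k0. cmod (F k - w) < \<epsilon>" if pos: "0 < \<epsilon>" for w \<epsilon> k0
  proof -
    obtain k1 where k1: "\<And>k. k \<ge> k1 \<Longrightarrow> cmod (F k - partial_sum (Suc k) t) < \<epsilon> / 2"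
      using lacunary_series_radial_close[of "\<epsilon> / 2"] pos unfolding eventually_sequentially F_def by auto
    \<comment> \<open>\<open>F k\<close> is compared with the partial sum of index
      \<open>Suc k\<close>, so the index found here needs a predecessor that is at least
      \<open>k0\<close> and \<open>k1\<close>.\<close>
    obtain k where k: "Suc (max k0 k1) \<le> k" "cmod (partial_sum k t - w) < \<epsilon> / 2"
      using dense[of "\<epsilon> / 2" "Suc (max k0 k1)" w] pos by auto
    then obtain k' where k': "k = Suc k'" by (cases k) auto
    have "cmod (F k' - w) \<le> cmod (F k' - partial_sum k t) + cmod (partial_sum k t - w)"
      using norm_triangle_ineq[of "F k' - partial_sum k t" "partial_sum k t - w"] by simp
    also have "\<dots> < \<epsilon>" using k1[of k'] k k' by simp
    finally show ?thesis using k k' by auto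
  qed
  \<comment> \<open>The target may move with the index: constant targets yield the finite cluster
    values, and the target \<open>m\<close> at index \<open>m\<close> yields infinity.\<close>
  have approx: "\<exists>s. radial_seq s \<and>
      (\<forall>m. cmod (lacunary_series (of_real (s m) * cis (2 * pi * t)) - w m) < 1 / (real m + 1))" for w :: "nat \<Rightarrow> complex"
  proof -
    have "\<exists>k\<ge>m. cmod (F k - w m) < 1 / (real m + 1)" for m
      by (rule F_dense) simp
    then obtain \<kappa> where \<kappa>: "\<And>m. \<kappa> m \<ge> m" "\<And>m. cmod (F (\<kappa> m) - w m) < 1 / (real m + 1)"
      by metis
    have "(\<lambda>m. radius (\<kappa> m)) \<longlonglongrightarrow> 1"
    proof (rule LIMSEQ_I)
      fix r :: real assume "0 < r"
      then obtain m0 :: nat where m0: "1 / (real m0 + 1) < r"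
        using reals_Archimedean[of r] by (auto simp: inverse_eq_divide add.commute)
      have "norm (radius (\<kappa> m) - 1) < r" if "m \<ge> m0" for m
      proof -
        have "1 / (real (\<kappa> m) + 1) \<le> 1 / (real m0 + 1)"
          using \<kappa>(1)[of m] that by (intro divide_left_mono) auto
        then show ?thesis using radius_bounds[of "\<kappa> m"] m0 by simp
      qed
      then show "\<exists>m0. \<forall>m\<ge>m0. norm (radius (\<kappa> m) - 1) < r" by blast
    qed
    then have "radial_seq (\<lambda>m. radius (\<kappa> m))"
      using radius_bounds by (simp add: radial_seq_def)
    then show ?thesis using \<kappa>(2) by (auto simp: F_def)
  qed
  have "Some w \<in> radial_cluster_set lacunary_series (cis (2 * pi * t))" for w
  proof -
    obtain s where s: "radial_seq s"
        "\<And>m. cmod (lacunary_series (of_real (s m) * cis (2 * pi * t)) - w) < 1 / (real m + 1)"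
      using approx[of "\<lambda>_. w"] by blast
    have "(\<lambda>m. lacunary_series (of_real (s m) * cis (2 * pi * t)) - w) \<longlonglongrightarrow> 0"
    proof (rule Lim_null_comparison)
      show "\<forall>\<^sub>F m in sequentially. cmod (lacunary_series (of_real (s m) * cis (2 * pi * t)) - w) \<le> inverse (real (Suc m))"
        using s(2) by (auto simp: inverse_eq_divide add.commute less_imp_le)
      show "(\<lambda>m. inverse (real (Suc m))) \<longlonglongrightarrow> 0" by (rule LIMSEQ_inverse_real_of_nat)
    qed
    then show ?thesis using s(1) unfolding radial_cluster_set_def by (auto simp: LIM_zero_iff)
  qed
  moreover have "None \<in> radial_cluster_set lacunary_series (cis (2 * pi * t))"
  proof -
    obtain s where s: "radial_seq s"
        "\<And>m. cmod (lacunary_series (of_real (s m) * cis (2 * pi * t)) - of_nat m) < 1 / (real m + 1)"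
      using approx[of of_nat] by blast
    have "filterlim (\<lambda>m. cmod (lacunary_series (of_real (s m) * cis (2 * pi * t)))) at_top sequentially"
    proof (rule filterlim_at_top_mono)
      show "filterlim (\<lambda>m. real m + (- 1)) at_top sequentially"
        by real_asymp
      show "\<forall>\<^sub>F m in sequentially. real m + (- 1) \<le> cmod (lacunary_series (of_real (s m) * cis (2 * pi * t)))"
      proof (rule always_eventually, rule allI)
        fix m
        let ?F = "lacunary_series (of_real (s m) * cis (2 * pi * t))"
        have "real m \<le> cmod ?F + cmod (?F - of_nat m)"
          using norm_triangle_ineq4[of ?F "?F - of_nat m"] by simp
        moreover have "1 / (real m + 1) \<le> 1" by simp
        ultimately show "real m + (- 1) \<le> cmod ?F"
          using s(2)[of m] by linarith
      qed
    qed
    then have "filterlim (\<lambda>m. lacunary_series (of_real (s m) * cis (2 * pi * t))) at_infinity sequentially"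
      by (rule filterlim_norm_at_top_imp_at_infinity)
    then show ?thesis using s(1) unfolding radial_cluster_set_def by auto
  qed
  ultimately have "x \<in> radial_cluster_set lacunary_series (cis (2 * pi * t))" for x
    by (cases x) auto
  then show ?thesis
    unfolding maximal_cluster_def by blast
qed

lemma lacunary_series_maximal_ae:
  defines "E \<equiv> {\<zeta> \<in> sphere 0 1. \<not> maximal_cluster (radial_cluster_set lacunary_series \<zeta>)}"
  shows "arc_null E"
proof -
  obtain Z where Z: "negligible Z"
    "\<And>t w \<epsilon> k0. t \<in> {0..<1} - Z \<Longrightarrow> 0 < \<epsilon> \<Longrightarrow> \<exists>k\<ge>k0. cmod (partial_sum k t - w) < \<epsilon>"
    by (rule partial_sums_dense) blast
  \<comment> \<open>The partial sums are parametrised by fractions of a turn, so the exceptional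
    angles lie in a rescaled copy of \<open>Z\<close>.\<close>
  have "{t \<in> {0..<2*pi}. cis t \<in> E} \<subseteq> (\<lambda>t. 2 * pi * t) ` Z"
  proof
    fix t assume t: "t \<in> {t \<in> {0..<2*pi}. cis t \<in> E}"
    define u where "u = t / (2 * pi)"
    have u: "u \<in> {0..<1}" "t = 2 * pi * u" using t by (auto simp: u_def)
    have "u \<in> Z"
    proof (rule ccontr)
      assume "u \<notin> Z"
      then have "maximal_cluster (radial_cluster_set lacunary_series (cis (2 * pi * u)))"
        using u(1) by (intro maximal_cluster_lacunary_series Z(2)) auto
      then show False using t u(2) by (simp add: E_def)
    qed
    then show "t \<in> (\<lambda>t. 2 * pi * t) ` Z" using u(2) by blast
  qed
  moreover have "negligible ((\<lambda>t. 2 * pi * t) ` Z)"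
    by (intro negligible_differentiable_image_negligible Z(1)) (auto intro!: derivative_intros)
  ultimately show ?thesis
    unfolding arc_null_def negligible_iff_null_sets[symmetric] by (rule negligible_subset[rotated])
qed

end

section \<open>A concrete choice of coefficients and exponents\<close>

lemma lacunary_factorial: "lacunary (\<lambda>k. 1 / sqrt (real k + 1)) (\<lambda>k. k + 3) (\<lambda>k. fact (k + 2))"
proof
  \<comment> \<open>The squares form the harmonic series, the cubes a convergent series with
    exponent \<open>3 / 2\<close>, and the quotients by \<open>k + 3\<close> are dominated by the
    cubes because \<open>k + 3\<close> exceeds the square of \<open>sqrt (k + 1)\<close>.\<close>
  have powr_eq: "1 / sqrt (real k + 1) = real (k + 1) powr - (1 / 2)" for k
    unfolding powr_minus by (simp add: powr_half_sqrt inverse_eq_divide add.commute)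
  have cube: "(1 / sqrt (real k + 1)) ^ 3 = real (k + 1) powr - (3 / 2)" for k
    unfolding powr_eq by (subst powr_power) simp_all
  have "summable (\<lambda>k. real (k + 1) powr - (3 / 2))"
    using summable_real_powr_iff[of "- (3 / 2)"] summable_iff_shift[of "\<lambda>k. real k powr - (3 / 2)" 1]
    by simp
  then show summable_cube: "summable (\<lambda>k. (1 / sqrt (real k + 1)) ^ 3)"
    unfolding cube .
  show "summable (\<lambda>k. 1 / sqrt (real k + 1) / real (k + 3))"
  proof (rule summable_comparison_test'[OF summable_cube, where N = 0])
    fix k
    have "1 / sqrt (real k + 1) / real (k + 3) \<le> 1 / sqrt (real k + 1) / (real k + 1)"
      by (intro divide_left_mono) auto
    also have "\<dots> = (1 / sqrt (real k + 1)) ^ 3"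
      by (simp add: power3_eq_cube)
    finally show "norm (1 / sqrt (real k + 1) / real (k + 3)) \<le> (1 / sqrt (real k + 1)) ^ 3"
      by simp
  qed
  have "\<not> summable (\<lambda>k. inverse (real (Suc k)))"
    using not_summable_harmonic[where 'a = real] summable_Suc_iff[of "\<lambda>k. inverse (real k)"]
    by (simp add: inverse_eq_divide)
  then show "\<not> summable (\<lambda>k. (1 / sqrt (real k + 1))\<^sup>2)"
    by (simp add: power_divide inverse_eq_divide add.commute)
  show "(\<lambda>k. 1 / sqrt (real k + 1)) \<longlonglongrightarrow> 0"
    by real_asymp
  show "fact (Suc k + 2) = (k + 3) * (fact (k + 2) :: nat)" for k
    by (simp add: numeral_eq_Suc)
qed simp_all

theorem theorem5p6:
  shows "U_R \<inter> Bloch = {} \<and>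
         (\<exists>E. E \<subseteq> sphere 0 1 \<and> arc_null E \<and> U_R_on (sphere 0 1 - E) \<inter> Bloch \<noteq> {})"
proof
  show "U_R \<inter> Bloch = {}" by (rule U_R_Bloch_disjoint)
  interpret lacunary "\<lambda>k. 1 / sqrt (real k + 1)" "\<lambda>k. k + 3" "\<lambda>k. fact (k + 2)"
    by (rule lacunary_factorial)
  define E where "E = {\<zeta> \<in> sphere 0 1. \<not> maximal_cluster (radial_cluster_set lacunary_series \<zeta>)}"
  have "arc_null E" unfolding E_def by (rule lacunary_series_maximal_ae)
  moreover have "lacunary_series \<in> U_R_on (sphere 0 1 - E)"
    using lacunary_series_Bloch by (auto simp: U_R_on_def E_def Bloch_def)
  ultimately show "\<exists>E. E \<subseteq> sphere 0 1 \<and> arc_null E \<and> U_R_on (sphere 0 1 - E) \<inter> Bloch \<noteq> {}"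
    using lacunary_series_Bloch by (intro exI[of _ E]) (auto simp: E_def)
qed

end
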